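(* Fix a real number $q$ with $0<q<\frac12$. For each integer $n\ge 1$, consider the two-phase game with parameters $(q,n)$ described in the context, and let $E_n(q)$ be the conditional expectation of the duration of Phase II given that team B wins. Then $E_n(q)\to\frac{1-q}{(1-2q)^2}$ as $n\to\infty$. More precisely, as $n\to\infty$, $$E_n(q)=\frac{1-q}{(1-2q)^2}\Bigg(1-\frac{1}{(1-2q)^2}\cdot\frac1n-\frac{6q^2-6q-1}{(1-2q)^4}\cdot\frac1{n^2}-\frac{36q^4-72q^3+12q^2+24q+1}{(1-2q)^6}\cdot\frac1{n^3}$$ $$\qquad-\frac{216q^6-648q^5+276q^4+528q^3-306q^2-66q-1}{(1-2q)^8}\cdot\frac1{n^4}\Bigg)+O\!\left(\frac1{n^5}\right).$$
   Context: The two-phase game with parameters $q\in(0,\frac12)$ and positive integer $n$: two teams, G and B, play; each successive goal is scored by B with probability $q$ and by G with probability $1-q$, independently of all other goals. Phase I: play until G has scored $n$ goals; let $m$ be the number of goals B has scored by then. Phase II: if $m\ge n$, team B is declared the winner immediately (Phase II has duration $0$). If $m<n$, they keep playing until B has caught up and tied the score, in which case B is declared the winner; if B never ties the score, B loses. The duration of Phase II is the number of goals scored (by either team) during Phase II. The implied constant in $O(\cdot)$ may depend on the fixed $q$. *)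

theory Defs
  imports "HOL-Probability.Probability" "HOL-Library.Landau_Symbols"
begin

text \<open>
  A game is an infinite sequence of goals \<^term>\<open>\<omega> :: nat \<Rightarrow> bool\<close>; \<^term>\<open>\<omega> i\<close> means that goal
  number \<^term>\<open>i\<close> (counted from 0) is scored by B, otherwise it is scored by G.
\<close>

definition goal_space :: "real \<Rightarrow> (nat \<Rightarrow> bool) measure" where
  "goal_space q = PiM UNIV (\<lambda>_. measure_pmf (bernoulli_pmf q))"

text \<open>Scores after the first \<^term>\<open>t\<close> goals.\<close>

definition score_B :: "(nat \<Rightarrow> bool) \<Rightarrow> nat \<Rightarrow> nat" where
  "score_B \<omega> t = card {i. i < t \<and> \<omega> i}"

definition score_G :: "(nat \<Rightarrow> bool) \<Rightarrow> nat \<Rightarrow> nat" where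
  "score_G \<omega> t = card {i. i < t \<and> \<not> \<omega> i}"

text \<open>
  The number of goals in Phase I. For \<^term>\<open>q < 1\<close>, G almost surely scores \<^term>\<open>n\<close> goals; on the
  remaining null event the value is unspecified.
\<close>

definition phase1_end :: "nat \<Rightarrow> (nat \<Rightarrow> bool) \<Rightarrow> nat" where
  "phase1_end n \<omega> = (LEAST t. score_G \<omega> t = n)"

definition tied_in_phase2 :: "nat \<Rightarrow> (nat \<Rightarrow> bool) \<Rightarrow> nat \<Rightarrow> bool" where
  "tied_in_phase2 n \<omega> d \<longleftrightarrow>
     score_B \<omega> (phase1_end n \<omega> + d) = score_G \<omega> (phase1_end n \<omega> + d)"

definition B_wins :: "nat \<Rightarrow> (nat \<Rightarrow> bool) \<Rightarrow> bool" where
  "B_wins n \<omega> \<longleftrightarrow> score_B \<omega> (phase1_end n \<omega>) \<ge> n \<or> (\<exists>d. tied_in_phase2 n \<omega> d)"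

text \<open>
  The duration is only meaningful if B wins: otherwise Phase II never ends and the value is
  unspecified.
\<close>

definition phase2_duration :: "nat \<Rightarrow> (nat \<Rightarrow> bool) \<Rightarrow> nat" where
  "phase2_duration n \<omega> =
     (if score_B \<omega> (phase1_end n \<omega>) \<ge> n then 0 else (LEAST d. tied_in_phase2 n \<omega> d))"

text \<open>
  Conditioning on an event of positive probability is integration with respect to the normalised
  restriction \<^const>\<open>uniform_measure\<close>.
\<close>

definition cond_expected_duration :: "nat \<Rightarrow> real \<Rightarrow> real" where
  "cond_expected_duration n q =
     (LINT \<omega> | uniform_measure (goal_space q) {\<omega> \<in> space (goal_space q). B_wins n \<omega>}.
        real (phase2_duration n \<omega>))"

end

theory Submission
  imports Defs
begin

text \<open>
  Write \<open>p = 1 - q\<close>. From a deficit of \<open>k\<close>, B ever ties with probability \<open>(q/p)^k\<close>, and the expected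
  duration on this event is \<open>k (q/p)^k / (1 - 2q)\<close>: both are the solutions of a first-step recursion
  that vanish as \<open>k \<rightarrow> \<infinity>\<close>. Averaging over the negative binomial score at the end of Phase I
  exchanges \<open>q\<close> and \<open>p\<close>, so that with \<open>L n = \<Sum>m<n. (n+m-1 choose m) q^n p^m\<close> and
  \<open>S n = \<Sum>m<n. (n+m-1 choose m) q^n p^m (n-m)\<close>, B wins with probability \<open>2 L n\<close> and
  \<open>E n = S n / (2 (1-2q) L n)\<close>.

  Let \<open>b n = (2n choose n) (pq)^n\<close>. Then \<open>L (n+1) = L n - (1-2q)/2 b n\<close> and
  \<open>q S n = n (b n / 2 - (1-2q) L n)\<close>, hence \<open>E n = n / (2q (1-2q)^2) (1 / U n - (1-2q)^2)\<close> for
  \<open>U n = 2 L n / ((1-2q) b n)\<close>, which satisfies \<open>U n = 1 + 4pq (2n+1)/(2n+2) U (n+1)\<close>. The rational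
  function \<open>u\<close> of \<open>n\<close> obtained from the claimed expansion satisfies the same recurrence up to
  \<open>O(1/n^6)\<close>. As \<open>4pq < 1\<close>, the recurrence is contracting and \<open>U n - u n = O(1/n^6)\<close>; the factor \<open>n\<close>
  in \<open>E n\<close> costs one order.
\<close>

subsection \<open>Decomposing the game at the first goal\<close>

lemma score_0 [simp]: "score_B \<omega> 0 = 0" "score_G \<omega> 0 = 0"
  by (simp_all add: score_B_def score_G_def)

lemma score_Suc:
  "score_B \<omega> (Suc t) = score_B \<omega> t + (if \<omega> t then 1 else 0)"
  "score_G \<omega> (Suc t) = score_G \<omega> t + (if \<omega> t then 0 else 1)"
proof -
  have "{i. i < Suc t \<and> P i} = (if P t then insert t {i. i < t \<and> P i} else {i. i < t \<and> P i})" for P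
    by (auto simp: less_Suc_eq)
  then show "score_B \<omega> (Suc t) = score_B \<omega> t + (if \<omega> t then 1 else 0)"
    "score_G \<omega> (Suc t) = score_G \<omega> t + (if \<omega> t then 0 else 1)"
    by (simp_all add: score_B_def score_G_def)
qed

lemma score_add:
  "score_B \<omega> (s + t) = score_B \<omega> s + score_B (\<lambda>i. \<omega> (s + i)) t"
  "score_G \<omega> (s + t) = score_G \<omega> s + score_G (\<lambda>i. \<omega> (s + i)) t"
  by (induction t) (auto simp: score_Suc)

lemma score_case_nat:
  "score_B (case_nat b \<omega>) (Suc t) = (if b then 1 else 0) + score_B \<omega> t"
  "score_G (case_nat b \<omega>) (Suc t) = (if b then 0 else 1) + score_G \<omega> t"
  by (induction t) (auto simp: score_Suc)

text \<open>Keeping the deficit \<open>k\<close> as a parameter closes the family under conditioning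
  on the first goal, which changes \<open>k\<close> by one.\<close>

definition tied_from :: "nat \<Rightarrow> (nat \<Rightarrow> bool) \<Rightarrow> nat \<Rightarrow> bool" where
  "tied_from k \<omega> d \<longleftrightarrow> score_B \<omega> d = score_G \<omega> d + k"

lemma tied_from_0 [simp]: "tied_from k \<omega> 0 \<longleftrightarrow> k = 0"
  by (auto simp: tied_from_def)

lemma tied_from_case_nat:
  "tied_from (Suc k) (case_nat b \<omega>) (Suc d) \<longleftrightarrow> tied_from (if b then k else Suc (Suc k)) \<omega> d"
  by (auto simp: tied_from_def score_case_nat)

text \<open>These events are disjoint for distinct \<open>t\<close>, so a payoff at the first tie is
  a countable sum that can be integrated term by term.\<close>

definition first_tie :: "nat \<Rightarrow> nat \<Rightarrow> (nat \<Rightarrow> bool) \<Rightarrow> bool" where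
  "first_tie k t \<omega> \<longleftrightarrow> tied_from k \<omega> t \<and> (\<forall>d<t. \<not> tied_from k \<omega> d)"

lemma first_tie_simps:
  "first_tie k 0 \<omega> \<longleftrightarrow> k = 0"
  "first_tie 0 (Suc t) \<omega> \<longleftrightarrow> False"
  "first_tie (Suc k) (Suc t) (case_nat b \<omega>) \<longleftrightarrow> first_tie (if b then k else Suc (Suc k)) t \<omega>"
  by (auto simp: first_tie_def tied_from_case_nat All_less_Suc2)

text \<open>
  The payoff \<open>c d\<close> if \<open>d\<close> is the first time at which B has made up a deficit of \<open>k\<close>, and \<open>0\<close> if
  there is no such time. The choices \<open>c = 1\<close> and \<open>c d = d\<close> give the winning event and the duration.
\<close>

definition at_tie :: "(nat \<Rightarrow> ennreal) \<Rightarrow> nat \<Rightarrow> (nat \<Rightarrow> bool) \<Rightarrow> ennreal" where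
  "at_tie c k \<omega> = (\<Sum>t. c t * indicator {\<omega>. first_tie k t \<omega>} \<omega>)"

lemma first_tie_unique: "first_tie k t \<omega> \<Longrightarrow> first_tie k t' \<omega> \<Longrightarrow> t' = t"
  unfolding first_tie_def by (metis linorder_neqE_nat)

lemma at_tie_eq:
  "at_tie c k \<omega> = (if \<exists>d. tied_from k \<omega> d then c (LEAST d. tied_from k \<omega> d) else 0)"
proof (cases "\<exists>d. tied_from k \<omega> d")
  case True
  let ?t = "LEAST d. tied_from k \<omega> d"
  have *: "first_tie k ?t \<omega>"
    using True unfolding first_tie_def by (meson LeastI_ex not_less_Least)
  have "at_tie c k \<omega> = (\<Sum>t\<in>{?t}. c t * indicator {\<omega>. first_tie k t \<omega>} \<omega>)"
    unfolding at_tie_def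
    by (rule suminf_finite) (auto simp: indicator_def dest: first_tie_unique[OF *])
  with * True show ?thesis by simp
next
  case False
  then have "\<not> first_tie k t \<omega>" for t
    by (auto simp: first_tie_def)
  with False show ?thesis by (simp add: at_tie_def)
qed

lemma at_tie_0 [simp]: "at_tie c 0 \<omega> = c 0"
proof -
  have "(LEAST d. tied_from 0 \<omega> d) = 0" by (rule Least_eq_0) simp
  moreover have "\<exists>d. tied_from 0 \<omega> d" by (rule exI[of _ 0]) simp
  ultimately show ?thesis by (simp add: at_tie_eq)
qed

section \<open>The end of Phase I\<close>

definition reaches :: "nat \<Rightarrow> (nat \<Rightarrow> bool) \<Rightarrow> bool" where
  "reaches g \<omega> \<longleftrightarrow> (\<exists>t. score_G \<omega> t = g)"

lemma reaches_0 [simp]: "reaches 0 \<omega>"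
  by (auto simp: reaches_def intro: exI[of _ 0])

lemma ex_nat_Suc: "(\<exists>t. P t) \<longleftrightarrow> P 0 \<or> (\<exists>t. P (Suc t))"
  by (metis not0_implies_Suc)

lemma reaches_case_nat:
  "reaches (Suc g) (case_nat b \<omega>) \<longleftrightarrow> reaches (if b then Suc g else g) \<omega>"
  unfolding reaches_def by (subst ex_nat_Suc) (auto simp: score_case_nat)

lemma phase1_end_0 [simp]: "phase1_end 0 \<omega> = 0"
  unfolding phase1_end_def by (rule Least_eq_0) simp

lemma phase1_end_case_nat:
  assumes "reaches (if b then Suc g else g) \<omega>"
  shows "phase1_end (Suc g) (case_nat b \<omega>) = Suc (phase1_end (if b then Suc g else g) \<omega>)"
proof -
  from assms have "reaches (Suc g) (case_nat b \<omega>)"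
    by (simp add: reaches_case_nat)
  then obtain t where t: "score_G (case_nat b \<omega>) t = Suc g" by (auto simp: reaches_def)
  \<comment> \<open>Time \<open>0\<close> is excluded because G needs a positive score, so the least
    time is a successor.\<close>
  have "phase1_end (Suc g) (case_nat b \<omega>) = Suc (LEAST t. score_G (case_nat b \<omega>) (Suc t) = Suc g)"
    unfolding phase1_end_def using t by (intro Least_Suc[of "\<lambda>t. score_G (case_nat b \<omega>) t = Suc g" t]) simp_all
  then show ?thesis by (cases b) (simp_all add: score_case_nat phase1_end_def)
qed

lemma score_G_phase1_end: "reaches g \<omega> \<Longrightarrow> score_G \<omega> (phase1_end g \<omega>) = g"
  unfolding reaches_def phase1_end_def by (rule LeastI_ex)

text \<open>
  Phase I ends when G has scored \<open>g\<close> goals, and B needs \<open>s\<close> goals by then to make Phase II trivial;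
  the game itself is the case \<open>g = s = n\<close>. If B has at least \<open>s\<close> goals, the truncated subtraction
  turns the deficit into \<open>0\<close>.
\<close>

definition phase2_payoff ::
    "(nat \<Rightarrow> ennreal) \<Rightarrow> nat \<Rightarrow> nat \<Rightarrow> (nat \<Rightarrow> bool) \<Rightarrow> ennreal" where
  "phase2_payoff c g s \<omega> = at_tie c (s - score_B \<omega> (phase1_end g \<omega>)) (\<lambda>i. \<omega> (phase1_end g \<omega> + i))"

lemma phase2_payoff_0 [simp]: "phase2_payoff c 0 s \<omega> = at_tie c s \<omega>" "phase2_payoff c g 0 \<omega> = c 0"
  by (simp_all add: phase2_payoff_def)

text \<open>Prepending a goal delays the end of Phase I by one, so the goals of Phase II are
  unchanged. A goal by B is absorbed into \<open>s\<close>, since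
  \<open>Suc s - (1 + x) = s - x\<close>; a goal by G lowers \<open>g\<close> instead.\<close>

lemma phase2_payoff_case_nat:
  assumes "reaches (if b then Suc g else g) \<omega>"
  shows "phase2_payoff c (Suc g) (Suc s) (case_nat b \<omega>) =
    (if b then phase2_payoff c (Suc g) s \<omega> else phase2_payoff c g (Suc s) \<omega>)"
  using phase1_end_case_nat[OF assms]
  by (cases b) (simp_all add: phase2_payoff_def score_case_nat)

text \<open>At the end of Phase I, G has exactly \<open>n\<close> goals, so a tie means that B
  outscores G afterwards by the deficit. The bound on \<open>score_B\<close> keeps the subtraction
  from truncating.\<close>

lemma tied_in_phase2_iff:
  assumes "reaches n \<omega>" "score_B \<omega> (phase1_end n \<omega>) \<le> n"
  shows "tied_in_phase2 n \<omega> d \<longleftrightarrow>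
    tied_from (n - score_B \<omega> (phase1_end n \<omega>)) (\<lambda>i. \<omega> (phase1_end n \<omega> + i)) d"
  using assms score_G_phase1_end[OF assms(1)]
  by (auto simp: tied_in_phase2_def tied_from_def score_add)

lemma phase2_payoff_diag:
  assumes "reaches n \<omega>"
  shows "phase2_payoff c n n \<omega> = (if B_wins n \<omega> then c (phase2_duration n \<omega>) else 0)"
proof (cases "score_B \<omega> (phase1_end n \<omega>) \<ge> n")
  case True
  then show ?thesis by (simp add: phase2_payoff_def B_wins_def phase2_duration_def)
next
  case False
  then have "tied_in_phase2 n \<omega> =
    tied_from (n - score_B \<omega> (phase1_end n \<omega>)) (\<lambda>i. \<omega> (phase1_end n \<omega> + i))"
    using tied_in_phase2_iff[OF assms] by auto
  with False show ?thesis
    by (simp add: phase2_payoff_def at_tie_eq B_wins_def phase2_duration_def)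
qed

subsection \<open>The probability space of goals\<close>

abbreviation goal_algebra :: "(nat \<Rightarrow> bool) measure" where
  "goal_algebra \<equiv> PiM UNIV (\<lambda>_. count_space UNIV)"

lemma sets_goal_space [measurable_cong]: "sets (goal_space q) = sets goal_algebra"
  unfolding goal_space_def by (rule sets_PiM_cong) simp_all

lemma space_goal_space [simp]: "space (goal_space q) = UNIV"
  by (simp add: goal_space_def space_PiM)

lemma measurable_goal [measurable]: "(\<lambda>\<omega>. \<omega> i) \<in> goal_algebra \<rightarrow>\<^sub>M count_space (UNIV :: bool set)"
  by (rule measurable_component_singleton) simp

lemma measurable_score [measurable]:
  "(\<lambda>\<omega>. score_B \<omega> t) \<in> goal_algebra \<rightarrow>\<^sub>M count_space UNIV"
  "(\<lambda>\<omega>. score_G \<omega> t) \<in> goal_algebra \<rightarrow>\<^sub>M count_space UNIV"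
  by (induction t) (simp_all add: score_Suc)

lemma measurable_phase1_end [measurable]: "phase1_end n \<in> goal_algebra \<rightarrow>\<^sub>M count_space UNIV"
  unfolding phase1_end_def by measurable

text \<open>Splitting over the countably many values of \<open>f\<close> reduces the claim to
  comparing \<open>g\<close> with a constant.\<close>

lemma pred_eq_nat:
  fixes f g :: "'a \<Rightarrow> nat"
  assumes "f \<in> M \<rightarrow>\<^sub>M count_space UNIV" and [measurable]: "g \<in> M \<rightarrow>\<^sub>M count_space UNIV"
  shows "Measurable.pred M (\<lambda>x. f x = g x)"
  by (rule measurable_compose_countable[OF _ assms(1)]) measurable

lemma measurable_tied_in_phase2 [measurable]: "Measurable.pred goal_algebra (\<lambda>\<omega>. tied_in_phase2 n \<omega> d)"
  unfolding tied_in_phase2_def by (intro pred_eq_nat) measurable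

lemma measurable_B_wins [measurable]: "Measurable.pred goal_algebra (B_wins n)"
  unfolding B_wins_def by measurable

lemma measurable_phase2_duration [measurable]:
  "phase2_duration n \<in> goal_algebra \<rightarrow>\<^sub>M count_space UNIV"
  unfolding phase2_duration_def by measurable

lemma measurable_reaches [measurable]: "Measurable.pred goal_algebra (reaches g)"
  unfolding reaches_def by measurable

lemma measurable_tied_from [measurable]: "Measurable.pred goal_algebra (\<lambda>\<omega>. tied_from k \<omega> t)"
  unfolding tied_from_def by (intro pred_eq_nat) measurable

lemma measurable_first_tie [measurable]: "Measurable.pred goal_algebra (first_tie k t)"
  unfolding first_tie_def by measurable

lemma measurable_at_tie [measurable]: "at_tie c k \<in> borel_measurable goal_algebra"
  unfolding at_tie_def by measurable

lemma measurable_shift: "(\<lambda>\<omega> i. \<omega> (t + i)) \<in> goal_algebra \<rightarrow>\<^sub>M goal_algebra"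
  by (rule measurable_PiM_single') (auto simp: space_PiM)

lemma measurable_phase2_payoff [measurable]: "phase2_payoff c g s \<in> borel_measurable goal_algebra"
proof -
  \<comment> \<open>The random end of Phase I and the random score at that time take countably many
    values, so each may be frozen at a constant.\<close>
  have "(\<lambda>\<omega>. at_tie c (s - score_B \<omega> t) (\<lambda>i. \<omega> (t + i))) \<in> borel_measurable goal_algebra" for t
  proof -
    have "(\<lambda>\<omega>. at_tie c (s - b) (\<lambda>i. \<omega> (t + i))) \<in> borel_measurable goal_algebra" for b
      by (rule measurable_compose[OF measurable_shift measurable_at_tie])
    then show ?thesis
      by (rule measurable_compose_countable[OF _ measurable_score(1)])
  qed
  then show ?thesis
    unfolding phase2_payoff_def by (rule measurable_compose_countable[OF _ measurable_phase1_end])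
qed

lemma prob_space_goal_space: "prob_space (goal_space q)"
  unfolding goal_space_def by (rule prob_space_PiM) (rule measure_pmf.prob_space_axioms)

text \<open>Prepending an independent goal leaves the law of the sequence unchanged
  (\<open>PiM_iter\<close>), so Tonelli integrates out the first goal. With nonnegative integrals no
  integrability has to be shown.\<close>

lemma nn_integral_first_goal:
  assumes q: "0 \<le> q" "q \<le> 1" and f [measurable]: "f \<in> borel_measurable goal_algebra"
  shows "(\<integral>\<^sup>+\<omega>. f \<omega> \<partial>goal_space q) =
    ennreal q * (\<integral>\<^sup>+\<omega>. f (case_nat True \<omega>) \<partial>goal_space q) +
    ennreal (1 - q) * (\<integral>\<^sup>+\<omega>. f (case_nat False \<omega>) \<partial>goal_space q)"
proof -
  let ?M = "measure_pmf (bernoulli_pmf q)" and ?S = "goal_space q"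
  interpret product_prob_space "\<lambda>_. ?M" "UNIV :: nat set" ..
  interpret sequence_space ?M ..
  interpret goal: prob_space ?S by (rule prob_space_goal_space)
  have S: "PiM UNIV (\<lambda>_. ?M) = ?S" by (simp add: goal_space_def)
  have cons: "(\<lambda>(b, \<omega>). case_nat b \<omega>) \<in> ?M \<Otimes>\<^sub>M ?S \<rightarrow>\<^sub>M ?S"
    unfolding goal_space_def by measurable
  have "f \<in> borel_measurable ?S" by measurable
  then have fc: "(\<lambda>(b, \<omega>). f (case_nat b \<omega>)) \<in> borel_measurable (?M \<Otimes>\<^sub>M ?S)"
    using measurable_comp[OF cons] by (simp add: o_def split_beta)
  have "(\<integral>\<^sup>+\<omega>. f \<omega> \<partial>?S) = (\<integral>\<^sup>+\<omega>. f \<omega> \<partial>distr (?M \<Otimes>\<^sub>M ?S) ?S (\<lambda>(b, \<omega>). case_nat b \<omega>))"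
    using PiM_iter by (simp add: S)
  also have "\<dots> = (\<integral>\<^sup>+z. f ((\<lambda>(b, \<omega>). case_nat b \<omega>) z) \<partial>(?M \<Otimes>\<^sub>M ?S))"
    by (rule nn_integral_distr[OF cons]) measurable
  also have "\<dots> = (\<integral>\<^sup>+b. \<integral>\<^sup>+\<omega>. f (case_nat b \<omega>) \<partial>?S \<partial>?M)"
    using goal.nn_integral_fst[OF fc] by (simp add: case_prod_unfold)
  also have "\<dots> = ennreal q * (\<integral>\<^sup>+\<omega>. f (case_nat True \<omega>) \<partial>?S) +
    ennreal (1 - q) * (\<integral>\<^sup>+\<omega>. f (case_nat False \<omega>) \<partial>?S)"
    using q by (simp add: mult.commute)
  finally show ?thesis .
qed

subsection \<open>Negative binomial sums\<close>

lemma binomial_Suc_pred_sum: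
  "(g + Suc m choose Suc m) = (g + m choose m) + (g + Suc m - 1 choose Suc m)"
  by simp

text \<open>For \<open>a + b = 1\<close> the weight of \<open>m\<close> is the negative binomial
  probability of \<open>m\<close> opposing goals before the \<open>g\<close>-th own goal;
  \<open>\<phi>\<close> is evaluated at the remaining deficit.\<close>

definition negbin_sum :: "real \<Rightarrow> real \<Rightarrow> (nat \<Rightarrow> real) \<Rightarrow> nat \<Rightarrow> nat \<Rightarrow> real" where
  "negbin_sum a b \<phi> g s = (\<Sum>m<s. real (g + m - 1 choose m) * a ^ g * b ^ m * \<phi> (s - m))"

lemma negbin_sum_0 [simp]:
  "negbin_sum a b \<phi> g 0 = 0" "negbin_sum a b \<phi> 0 (Suc s) = \<phi> (Suc s)"
proof -
  have "(m - 1 choose m) = (if m = 0 then 1 else 0)" for m :: nat by (cases m) auto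
  then have "real (0 + m - 1 choose m) * a ^ 0 * b ^ m * \<phi> (Suc s - m) =
    (if m = 0 then \<phi> (Suc s) else 0)" for m by simp
  then show "negbin_sum a b \<phi> 0 (Suc s) = \<phi> (Suc s)"
    by (simp add: negbin_sum_def sum.delta)
qed (simp add: negbin_sum_def)

text \<open>Pascal's rule, after splitting off the summand \<open>m = 0\<close>. For
  \<open>a + b = 1\<close> this is conditioning on the first goal.\<close>

lemma negbin_sum_Suc_Suc:
  "negbin_sum a b \<phi> (Suc g) (Suc s) = b * negbin_sum a b \<phi> (Suc g) s + a * negbin_sum a b \<phi> g (Suc s)"
proof -
  have 1: "negbin_sum a b \<phi> (Suc g) (Suc s) = a ^ Suc g * \<phi> (Suc s) +
      (\<Sum>m<s. real (g + Suc m choose Suc m) * a ^ Suc g * b ^ Suc m * \<phi> (s - m))"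
    by (simp add: negbin_sum_def sum.lessThan_Suc_shift del: sum.lessThan_Suc binomial_Suc_Suc)
  have 2: "a * negbin_sum a b \<phi> g (Suc s) = a ^ Suc g * \<phi> (Suc s) +
      (\<Sum>m<s. real (g + Suc m - 1 choose Suc m) * a ^ Suc g * b ^ Suc m * \<phi> (s - m))"
    by (simp add: negbin_sum_def sum.lessThan_Suc_shift sum_distrib_left algebra_simps
        del: sum.lessThan_Suc binomial_Suc_Suc)
  have 3: "b * negbin_sum a b \<phi> (Suc g) s =
      (\<Sum>m<s. real (g + m choose m) * a ^ Suc g * b ^ Suc m * \<phi> (s - m))"
    by (simp add: negbin_sum_def sum_distrib_left algebra_simps)
  show ?thesis
    unfolding 1 2 3 binomial_Suc_pred_sum of_nat_add
    by (simp add: sum.distrib algebra_simps)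
qed

lemma negbin_sum_nonneg:
  assumes "0 \<le> a" "0 \<le> b" "\<And>j. 0 < j \<Longrightarrow> 0 \<le> \<phi> j"
  shows "0 \<le> negbin_sum a b \<phi> g s"
  unfolding negbin_sum_def using assms by (intro sum_nonneg mult_nonneg_nonneg) auto

text \<open>
  The probability \<open>(b / a) ^ j\<close> of making up a deficit of \<open>j\<close> exchanges the roles of \<open>a\<close> and \<open>b\<close>.
\<close>

lemma negbin_sum_tilt:
  assumes "a \<noteq> 0"
  shows "negbin_sum a b (\<lambda>j. (b / a) ^ j * \<phi> j) n n = negbin_sum b a \<phi> n n"
  unfolding negbin_sum_def
proof (rule sum.cong)
  fix m assume "m \<in> {..<n}"
  then obtain j where n: "n = m + j" using less_imp_add_positive by blast
  have "a ^ n * b ^ m * (b / a) ^ (n - m) = b ^ n * a ^ m"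
    using assms by (simp add: n power_add field_simps)
  then show "real (n + m - 1 choose m) * a ^ n * b ^ m * ((b / a) ^ (n - m) * \<phi> (n - m)) =
    real (n + m - 1 choose m) * b ^ n * a ^ m * \<phi> (n - m)"
    by (simp flip: mult.assoc)
qed simp

text \<open>
  The probability that a team scoring each goal with probability \<open>q\<close> is the first to have \<open>n\<close> goals.
\<close>

definition race_prob :: "real \<Rightarrow> nat \<Rightarrow> real" where
  "race_prob q n = negbin_sum q (1 - q) (\<lambda>_. 1) n n"

lemma negbin_sum_Suc_right:
  "negbin_sum a b (\<lambda>_. 1) g (Suc s) = negbin_sum a b (\<lambda>_. 1) g s + real (g + s - 1 choose s) * a ^ g * b ^ s"
  by (simp add: negbin_sum_def)

lemma central_binomial: "2 * (2 * n + 1 choose Suc n) = (2 * n + 2 choose Suc n)"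
  using binomial_symmetric[of n "2*n+1"] by simp

text \<open>The step from \<open>(n, n)\<close> to \<open>(n + 1, n + 1)\<close> passes through
  \<open>(n + 1, n)\<close> and \<open>(n, n + 1)\<close>: raising \<open>s\<close> adds one
  boundary term, and the recursion links the corners. Both boundary terms are multiples of the
  central binomial coefficient.\<close>

lemma race_prob_Suc:
  assumes "0 < n"
  shows "race_prob q (Suc n) = race_prob q n - (1 - 2 * q) / 2 * real (2 * n choose n) * (q * (1 - q)) ^ n"
\<comment> \<open>The argument yields the identity multiplied by \<open>q\<close>, so
  \<open>q = 0\<close> is treated apart.\<close>
proof (cases "q = 0")
  case False
  obtain k where n: "n = Suc k" using assms gr0_implies_Suc by blast
  define c where "c = real (2 * n choose n)"
  let ?w = "negbin_sum q (1 - q) (\<lambda>_. 1)"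
  have c2: "2 * real (n + n - 1 choose n) = c"
  proof -
    have "n + n - 1 = 2 * k + 1" "2 * n = 2 * k + 2" using n by simp_all
    then have "2 * (n + n - 1 choose n) = (2 * n choose n)"
      using central_binomial[of k] n by (simp only:)
    then show ?thesis unfolding c_def by (metis of_nat_mult of_nat_numeral)
  qed
  have 1: "?w (Suc n) (Suc n) = ?w (Suc n) n + c * q ^ Suc n * (1 - q) ^ n"
    using negbin_sum_Suc_right[of q "1-q" "Suc n" n] by (simp add: c_def mult_2)
  have 2: "?w n (Suc n) = ?w n n + c / 2 * q ^ n * (1 - q) ^ n"
    using negbin_sum_Suc_right[of q "1-q" n n] c2 by (simp del: of_nat_add)
  have 3: "?w (Suc n) (Suc n) = (1 - q) * ?w (Suc n) n + q * ?w n (Suc n)"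
    by (rule negbin_sum_Suc_Suc)
  have "?w (Suc n) (Suc n) = (1 - q) * (?w (Suc n) (Suc n) - c * q ^ Suc n * (1 - q) ^ n) +
    q * (?w n n + c / 2 * q ^ n * (1 - q) ^ n)"
    using 1 3 unfolding 2 by simp
  then have "q * ?w (Suc n) (Suc n) = q * (?w n n - (1 - 2 * q) / 2 * c * (q * (1 - q)) ^ n)"
    unfolding power_mult_distrib power_Suc by (simp add: field_simps)
  with False show ?thesis by (simp add: race_prob_def c_def)
next
  case True
  with assms show ?thesis by (simp add: race_prob_def negbin_sum_def power_0_left)
qed

lemma race_prob_1 [simp]: "race_prob q (Suc 0) = q"
  by (simp add: race_prob_def negbin_sum_def)

text \<open>Exchanging \<open>q\<close> and \<open>1 - q\<close> flips the sign of the increment in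
  \<open>race_prob_Suc\<close>, so the sum keeps its value at \<open>n = 1\<close>.\<close>

lemma race_prob_complement:
  assumes "0 < n"
  shows "race_prob q n + race_prob (1 - q) n = 1"
  using assms
proof (induction n rule: nat_induct_non_zero)
  case (Suc n)
  then show ?case by (simp add: race_prob_Suc field_simps)
qed simp

lemma race_prob_nonneg: "0 \<le> q \<Longrightarrow> q \<le> 1 \<Longrightarrow> 0 \<le> race_prob q n"
  unfolding race_prob_def by (rule negbin_sum_nonneg) auto

text \<open>Comparison with the fair race, which is won with probability \<open>1/2\<close>. For
  \<open>m < n\<close> the ratio of the weights is \<open>(2q)^n (2(1-q))^m\<close>, and
  \<open>2(1-q) \<ge> 1\<close> allows \<open>m\<close> to be replaced by \<open>n\<close>.\<close>

lemma race_prob_le: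
  assumes "0 \<le> q" "q \<le> 1 / 2" "0 < n"
  shows "race_prob q n \<le> (4 * (q * (1 - q))) ^ n / 2"
proof -
  have half: "race_prob (1 / 2) n = 1 / 2"
    using race_prob_complement[OF assms(3), of "1/2"] by simp
  have "race_prob q n \<le> (4 * (q * (1 - q))) ^ n * race_prob (1 / 2) n"
    unfolding race_prob_def negbin_sum_def sum_distrib_left
  proof (rule sum_mono)
    fix m assume "m \<in> {..<n}"
    then have "(2 * (1 - q)) ^ m \<le> (2 * (1 - q)) ^ n"
      using assms by (intro power_increasing) auto
    then have "(2 * q) ^ n * (2 * (1 - q)) ^ m \<le> (2 * q) ^ n * (2 * (1 - q)) ^ n"
      using assms by (intro mult_left_mono) auto
    also have "\<dots> = (4 * (q * (1 - q))) ^ n"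
      unfolding power_mult_distrib[symmetric] by (rule arg_cong[where f = "\<lambda>x. x ^ n"]) simp
    finally have "((2 * q) ^ n * (2 * (1 - q)) ^ m) * ((1 / 2) ^ n * (1 / 2) ^ m) \<le>
      (4 * (q * (1 - q))) ^ n * ((1 / 2) ^ n * (1 / 2) ^ m)"
      by (rule mult_right_mono) simp
    moreover have "((2 * q) ^ n * (2 * (1 - q)) ^ m) * ((1 / 2) ^ n * (1 / 2) ^ m) = q ^ n * (1 - q) ^ m"
      unfolding power_mult_distrib by (simp add: power_one_over)
    ultimately have "q ^ n * (1 - q) ^ m \<le> (4 * (q * (1 - q))) ^ n * ((1 / 2) ^ n * (1 / 2) ^ m)"
      by (simp only:)
    note le = mult_left_mono[OF this of_nat_0_le_iff[of "n + m - 1 choose m"]]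
    show "real (n + m - 1 choose m) * q ^ n * (1 - q) ^ m * 1 \<le> (4 * (q * (1 - q))) ^ n *
      (real (n + m - 1 choose m) * (1 / 2) ^ n * (1 - 1 / 2) ^ m * 1)"
    proof -
      have "1 - 1 / 2 = (1 / 2 :: real)" by simp
      with le show ?thesis by (simp only: mult_ac mult_1_right)
    qed
  qed
  then show ?thesis unfolding half by simp
qed

lemma negbin_sum_id_Suc:
  "negbin_sum a b real g (Suc s) = negbin_sum a b real g s + negbin_sum a b (\<lambda>_. 1) g (Suc s)"
proof -
  \<comment> \<open>The added summand \<open>m = s\<close> of the first sum vanishes because
    \<open>s - m = 0\<close>; now both sums have the same range.\<close>
  have "negbin_sum a b real g s + negbin_sum a b (\<lambda>_. 1) g (Suc s) =
    (\<Sum>m<Suc s. real (g + m - 1 choose m) * a ^ g * b ^ m * real (s - m)) +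
    (\<Sum>m<Suc s. real (g + m - 1 choose m) * a ^ g * b ^ m * 1)"
    by (simp add: negbin_sum_def)
  also have "\<dots> = (\<Sum>m<Suc s. real (g + m - 1 choose m) * a ^ g * b ^ m * real (Suc s - m))"
    unfolding sum.distrib[symmetric] by (intro sum.cong) (auto simp: Suc_diff_le algebra_simps)
  finally show ?thesis by (simp add: negbin_sum_def)
qed

lemma central_binomial_Suc:
  "real (Suc n) * real (2 * Suc n choose Suc n) = 2 * (2 * real n + 1) * real (2 * n choose n)"
proof -
  have "Suc n * (2 * n + 1 choose n) = (2 * n + 1) * (2 * n choose n)"
  proof -
    have "2 * n + 1 - n = Suc n" "2 * n + 1 - 1 = 2 * n" by simp_all
    then show ?thesis using binomial_absorb_comp[of "2*n+1" n] by (simp only:)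
  qed
  moreover have "(2 * Suc n choose Suc n) = 2 * (2 * n + 1 choose n)"
    using central_binomial[of n] binomial_symmetric[of n "2*n+1"] by (simp del: binomial_Suc_Suc)
  ultimately have "Suc n * (2 * Suc n choose Suc n) = 2 * (2 * n + 1) * (2 * n choose n)"
    by (simp del: binomial_Suc_Suc mult_Suc_right mult_Suc)
  then have "real (Suc n * (2 * Suc n choose Suc n)) = real (2 * (2 * n + 1) * (2 * n choose n))"
    by (rule arg_cong)
  then show ?thesis unfolding of_nat_mult by (simp del: binomial_Suc_Suc)
qed

text \<open>Induction along the diagonal through the same corners as in
  \<open>race_prob_Suc\<close>; \<open>central_binomial_Suc\<close> absorbs the factor
  \<open>2n + 1\<close> into the next central binomial coefficient.\<close>

lemma negbin_sum_id_diag: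
  assumes "0 < n"
  shows "q * negbin_sum q (1 - q) real n n =
    real n * (real (2 * n choose n) * (q * (1 - q)) ^ n / 2 - (1 - 2 * q) * race_prob q n)"
  using assms
proof (induction n rule: nat_induct_non_zero)
  case 1
  show ?case by (simp add: negbin_sum_def field_simps)
next
  case (Suc n)
  let ?w = "negbin_sum q (1 - q) (\<lambda>_. 1)" and ?z = "negbin_sum q (1 - q) real"
  define c where "c = real (2 * n choose n)"
  define c' where "c' = real (2 * Suc n choose Suc n)"
  define P where "P = (q * (1 - q)) ^ n"
  have cc: "real (Suc n) * c' = 2 * (2 * real n + 1) * c"
    unfolding c_def c'_def by (rule central_binomial_Suc)
  have L: "?w (Suc n) (Suc n) = ?w n n - (1 - 2 * q) / 2 * c * P"
    using race_prob_Suc[of n q] Suc by (simp add: race_prob_def c_def P_def)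
  have "?w (Suc n) (Suc n) = ?w (Suc n) n + c * q ^ Suc n * (1 - q) ^ n"
    using negbin_sum_Suc_right[of q "1-q" "Suc n" n] by (simp add: c_def mult_2)
  then have W: "?w (Suc n) n = ?w (Suc n) (Suc n) - q * c * P"
    by (simp add: P_def power_mult_distrib)
  have "q * ?w n (Suc n) = ?w (Suc n) (Suc n) - (1 - q) * ?w (Suc n) n"
    using negbin_sum_Suc_Suc[of q "1-q" _ n n] by simp
  also have "\<dots> = q * ?w (Suc n) (Suc n) + (1 - q) * q * c * P"
    unfolding W by (simp add: algebra_simps)
  finally have W': "q * ?w n (Suc n) = q * ?w (Suc n) (Suc n) + (1 - q) * q * c * P" .
  have IH: "q * ?z n n = real n * (c * P / 2 - (1 - 2 * q) * ?w n n)"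
    using Suc by (simp add: c_def P_def race_prob_def)
  have "?z (Suc n) (Suc n) = (1 - q) * ?z (Suc n) n + q * (?z n n + ?w n (Suc n))"
    using negbin_sum_Suc_Suc negbin_sum_id_Suc by metis
  \<comment> \<open>The unknown reappears on the right with weight \<open>1 - q\<close>; moving it
    over leaves the factor \<open>q\<close>.\<close>
  also have "?z (Suc n) n = ?z (Suc n) (Suc n) - ?w (Suc n) (Suc n)"
    by (simp add: negbin_sum_id_Suc)
  finally have "q * ?z (Suc n) (Suc n) = q * ?z n n + q * ?w n (Suc n) - (1 - q) * ?w (Suc n) (Suc n)"
    by (simp add: algebra_simps)
  also have "\<dots> = (2 * real n + 1) * c * (q * (1 - q) * P) - (real n + 1) * (1 - 2 * q) * ?w (Suc n) (Suc n)"
    unfolding W' IH L by (simp add: field_simps)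
  also have "\<dots> = real (Suc n) * c' * (q * (1 - q) * P) / 2 - real (Suc n) * (1 - 2 * q) * ?w (Suc n) (Suc n)"
    unfolding cc by (simp add: field_simps)
  finally show ?case
    by (simp add: race_prob_def c'_def P_def algebra_simps del: binomial_Suc_Suc mult_Suc_right)
qed

subsection \<open>The distribution of the first tie\<close>

text \<open>The law of the first time at which a biased walk makes up a deficit
  \<open>k\<close>.\<close>

fun tie_prob :: "real \<Rightarrow> nat \<Rightarrow> nat \<Rightarrow> real" where
  "tie_prob q 0 k = (if k = 0 then 1 else 0)"
| "tie_prob q (Suc t) 0 = 0"
| "tie_prob q (Suc t) (Suc k) = q * tie_prob q t k + (1 - q) * tie_prob q t (Suc (Suc k))"

lemma tie_prob_nonneg: "0 \<le> q \<Longrightarrow> q \<le> 1 \<Longrightarrow> 0 \<le> tie_prob q t k"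
  by (induction q t k rule: tie_prob.induct) auto

text \<open>The odds \<open>r\<close> are a root of the characteristic equation
  \<open>(1 - q) * r ^ 2 - r + q = 0\<close> of the first-step recursion.\<close>

lemma odds_power_harmonic:
  fixes q :: real
  assumes "q < 1"
  shows "q * (q / (1 - q)) ^ k + (1 - q) * (q / (1 - q)) ^ Suc (Suc k) = (q / (1 - q)) ^ Suc k"
proof -
  define r where "r = q / (1 - q)"
  have r: "(1 - q) * r = q" using assms by (simp add: r_def)
  have "q * r ^ k = (1 - q) * r ^ Suc k" "(1 - q) * r ^ Suc (Suc k) = q * r ^ Suc k"
    using r by (simp_all flip: mult.assoc)
  then show ?thesis by (simp add: algebra_simps flip: r_def)
qed

text \<open>The first-step recursion for the duration on the event of a tie. The source term counts
  the goal just played, weighted by the probability of ever tying.\<close>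

lemma weighted_odds_power:
  fixes q :: real
  assumes "q < 1 / 2"
  shows "q * (real k * (q / (1 - q)) ^ k / (1 - 2 * q)) +
    (1 - q) * (real (Suc (Suc k)) * (q / (1 - q)) ^ Suc (Suc k) / (1 - 2 * q)) + (q / (1 - q)) ^ Suc k =
    real (Suc k) * (q / (1 - q)) ^ Suc k / (1 - 2 * q)"
proof -
  define r where "r = q / (1 - q)"
  define R where "R = r ^ Suc k"
  have r: "(1 - q) * r = q" using assms by (simp add: r_def)
  have 1: "q * r ^ k = (1 - q) * R" "(1 - q) * r ^ Suc (Suc k) = q * R"
    using r by (simp_all add: R_def flip: mult.assoc)
  have "q * (real k * r ^ k / (1 - 2 * q)) + (1 - q) * (real (Suc (Suc k)) * r ^ Suc (Suc k) / (1 - 2 * q)) + R =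
    (real k * (q * r ^ k) + real (Suc (Suc k)) * ((1 - q) * r ^ Suc (Suc k))) / (1 - 2 * q) + R"
    by (simp only: add_divide_distrib times_divide_eq_right mult_ac)
  also have "\<dots> = real (Suc k) * R / (1 - 2 * q)"
    unfolding 1 using assms by (simp add: field_simps)
  finally show ?thesis unfolding R_def r_def .
qed

text \<open>The candidate value solves the recursion that the partial sums obey with
  \<open>N\<close> lowered by one, so it majorises them. This gives summability before the sum is
  identified.\<close>

lemma sum_tie_prob_le:
  assumes "0 < q" "q < 1"
  shows "(\<Sum>t<N. tie_prob q t k) \<le> (q / (1 - q)) ^ k"
proof (induction N arbitrary: k)
  case (Suc N)
  show ?case
  proof (cases k)
    case (Suc j)
    let ?r = "q / (1 - q)"
    have "(\<Sum>t<Suc N. tie_prob q t k) =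
      q * (\<Sum>t<N. tie_prob q t j) + (1 - q) * (\<Sum>t<N. tie_prob q t (Suc (Suc j)))"
      by (simp add: Suc sum.lessThan_Suc_shift sum.distrib sum_distrib_left del: sum.lessThan_Suc)
    also have "\<dots> \<le> q * ?r ^ j + (1 - q) * ?r ^ Suc (Suc j)"
      using assms by (intro add_mono mult_left_mono Suc.IH) auto
    also have "\<dots> = ?r ^ k"
      unfolding Suc using assms by (intro odds_power_harmonic) simp
    finally show ?thesis .
  qed (simp add: sum.lessThan_Suc_shift del: sum.lessThan_Suc)
qed (use assms in auto)

lemma sum_weighted_tie_prob_le:
  assumes "0 < q" "q < 1 / 2"
  shows "(\<Sum>t<N. real t * tie_prob q t k) \<le> real k * (q / (1 - q)) ^ k / (1 - 2 * q)"
proof (induction N arbitrary: k)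
  case 0
  then show ?case using assms by simp
next
  case (Suc N)
  show ?case
  proof (cases k)
    case (Suc j)
    let ?r = "q / (1 - q)" and ?d = "1 - 2 * q"
    have r: "(1 - q) * ?r = q" using assms by simp
    have "(\<Sum>t<Suc N. real t * tie_prob q t k) =
      q * ((\<Sum>t<N. real t * tie_prob q t j) + (\<Sum>t<N. tie_prob q t j)) +
      (1 - q) * ((\<Sum>t<N. real t * tie_prob q t (Suc (Suc j))) + (\<Sum>t<N. tie_prob q t (Suc (Suc j))))"
    proof -
      have "real (Suc t) * tie_prob q (Suc t) k =
        q * (real t * tie_prob q t j) + q * tie_prob q t j +
        ((1 - q) * (real t * tie_prob q t (Suc (Suc j))) + (1 - q) * tie_prob q t (Suc (Suc j)))" for t
        by (simp add: Suc algebra_simps)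
      then show ?thesis
        by (simp only: sum.lessThan_Suc_shift sum.distrib sum_distrib_left distrib_left)
    qed
    also have "\<dots> \<le> q * (real j * ?r ^ j / ?d + ?r ^ j) +
      (1 - q) * (real (Suc (Suc j)) * ?r ^ Suc (Suc j) / ?d + ?r ^ Suc (Suc j))"
      using assms by (intro add_mono mult_left_mono Suc.IH sum_tie_prob_le) auto
    also have "\<dots> = (q * (real j * ?r ^ j / ?d) + (1 - q) * (real (Suc (Suc j)) * ?r ^ Suc (Suc j) / ?d)) +
      (q * ?r ^ j + (1 - q) * ?r ^ Suc (Suc j))"
      by (simp only: distrib_left add_ac)
    also have "\<dots> = real k * ?r ^ k / ?d"
      using odds_power_harmonic[of q j] weighted_odds_power[of q j] assms by (simp only: Suc)
    finally show ?thesis .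
  qed (simp add: sum.lessThan_Suc_shift del: sum.lessThan_Suc)
qed

section \<open>Exact sums from the first-step recursion\<close>

lemma sums_nonneg_bounded:
  fixes f :: "nat \<Rightarrow> real"
  assumes "\<And>t. 0 \<le> f t" "\<And>N. (\<Sum>t<N. f t) \<le> B"
  shows "f sums suminf f" "0 \<le> suminf f" "suminf f \<le> B"
proof -
  have "summable f" using assms by (rule summableI_nonneg_bounded)
  then show "f sums suminf f" "0 \<le> suminf f" "suminf f \<le> B"
    using assms by (auto intro: summable_sums suminf_nonneg suminf_le_const)
qed

text \<open>The increments of \<open>D\<close> are geometric with ratio
  \<open>q / (1 - q) < 1\<close>, so \<open>D\<close> converges to a nonzero multiple of
  \<open>D 1\<close>; the limit \<open>0\<close> forces \<open>D 1 = 0\<close>.\<close>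

lemma harmonic_vanishing:
  fixes D :: "nat \<Rightarrow> real"
  assumes q: "0 < q" "q < 1 / 2" and D0: "D 0 = 0"
    and rec: "\<And>k. D (Suc k) = q * D k + (1 - q) * D (Suc (Suc k))"
    and lim: "D \<longlonglongrightarrow> 0"
  shows "D k = 0"
proof -
  let ?r = "q / (1 - q)"
  have step: "D (Suc k) - D k = ?r ^ k * D 1" for k
  proof (induction k)
    case (Suc k)
    have "(1 - q) * (D (Suc (Suc k)) - D (Suc k)) = q * (D (Suc k) - D k)"
      using rec[of k] by (simp add: algebra_simps)
    with Suc have "(1 - q) * (D (Suc (Suc k)) - D (Suc k)) = q * (?r ^ k * D 1)" by simp
    with q show ?case by (simp add: field_simps)
  qed (simp add: D0)
  have D: "D k = D 1 * (\<Sum>i<k. ?r ^ i)" for k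
  proof (induction k)
    case (Suc k)
    then show ?case using step[of k] by (simp add: algebra_simps)
  qed (simp add: D0)
  have "(\<lambda>k. D 1 * (\<Sum>i<k. ?r ^ i)) \<longlonglongrightarrow> D 1 * (1 / (1 - ?r))"
    using geometric_sums[of ?r] q unfolding sums_def by (intro tendsto_mult tendsto_const) simp
  then have "D 1 * (1 / (1 - ?r)) = 0"
    using lim LIMSEQ_unique unfolding D[symmetric] by blast
  then have "D 1 = 0" using q by (simp add: field_simps)
  then show ?thesis by (subst D) simp
qed

lemma tendsto_zero_remainder:
  fixes g h :: "nat \<Rightarrow> real"
  assumes "g \<longlonglongrightarrow> 0" "\<And>k. 0 \<le> h k" "\<And>k. h k \<le> g k"
  shows "(\<lambda>k. g k - h k) \<longlonglongrightarrow> 0"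
proof (rule Lim_null_comparison[OF always_eventually assms(1)], rule allI)
  show "norm (g k - h k) \<le> g k" for k using assms(2,3)[of k] by simp
qed

lemma sums_shift_first_zero:
  fixes f :: "nat \<Rightarrow> real"
  assumes "f 0 = 0" "(\<lambda>t. f (Suc t)) sums x"
  shows "f sums x"
  using assms sums_Suc[of f x] by simp

text \<open>The sum and the power solve the same recursion and agree at \<open>k = 0\<close>. Their
  difference lies between \<open>0\<close> and the power, so it vanishes at infinity and hence
  everywhere.\<close>

lemma tie_prob_sums:
  assumes q: "0 < q" "q < 1 / 2"
  shows "(\<lambda>t. tie_prob q t k) sums (q / (1 - q)) ^ k"
proof -
  let ?r = "q / (1 - q)"
  define h where "h k = (\<Sum>t. tie_prob q t k)" for k
  have h: "(\<lambda>t. tie_prob q t k) sums h k" "0 \<le> h k" "h k \<le> ?r ^ k" for k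
    unfolding h_def using q
    by (intro sums_nonneg_bounded[where B = "?r ^ k"] tie_prob_nonneg sum_tie_prob_le; simp)+
  have h0: "h 0 = 1"
  proof -
    have "(\<lambda>t. tie_prob q t 0) sums (\<Sum>t\<in>{0}. tie_prob q t 0)"
    proof (rule sums_finite)
      fix t :: nat assume "t \<notin> {0}"
      then show "tie_prob q t 0 = 0" by (cases t) auto
    qed simp
    then show ?thesis using h(1)[of 0] sums_unique2 by fastforce
  qed
  have rec: "h (Suc k) = q * h k + (1 - q) * h (Suc (Suc k))" for k
  proof -
    have "(\<lambda>t. tie_prob q (Suc t) (Suc k)) sums (q * h k + (1 - q) * h (Suc (Suc k)))"
      by (auto intro!: sums_add sums_mult h)
    then show ?thesis using h(1)[of "Suc k"] sums_shift_first_zero[of "\<lambda>t. tie_prob q t (Suc k)"]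
      by (auto dest: sums_unique2)
  qed
  have r: "0 < ?r" "?r < 1" using q by auto
  have q1: "q < 1" using q by simp
  have "?r ^ k - h k = 0"
  proof (rule harmonic_vanishing[OF q, of "\<lambda>k. ?r ^ k - h k"])
    show "?r ^ Suc k - h (Suc k) = q * (?r ^ k - h k) + (1 - q) * (?r ^ Suc (Suc k) - h (Suc (Suc k)))" for k
      unfolding rec[of k] odds_power_harmonic[OF q1, of k, symmetric] by (simp only: right_diff_distrib)
    have "(\<lambda>k. ?r ^ k) \<longlonglongrightarrow> 0" using r by (intro LIMSEQ_realpow_zero) auto
    then show "(\<lambda>k. ?r ^ k - h k) \<longlonglongrightarrow> 0"
      by (rule tendsto_zero_remainder) (rule h(2,3))+
  qed (simp add: h0)
  then show ?thesis using h(1)[of k] by simp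
qed

lemma weighted_tie_prob_sums:
  assumes q: "0 < q" "q < 1 / 2"
  shows "(\<lambda>t. real t * tie_prob q t k) sums (real k * (q / (1 - q)) ^ k / (1 - 2 * q))"
proof -
  let ?r = "q / (1 - q)" and ?d = "1 - 2 * q"
  define e where "e k = (\<Sum>t. real t * tie_prob q t k)" for k
  have e: "(\<lambda>t. real t * tie_prob q t k) sums e k" "0 \<le> e k" "e k \<le> real k * ?r ^ k / ?d" for k
    unfolding e_def using q
    by (intro sums_nonneg_bounded[where B = "real k * ?r ^ k / ?d"] mult_nonneg_nonneg tie_prob_nonneg
        sum_weighted_tie_prob_le; simp)+
  have rec: "e (Suc k) = q * e k + (1 - q) * e (Suc (Suc k)) + ?r ^ Suc k" for k
  proof -
    have "(\<lambda>t. q * (real t * tie_prob q t k) + (1 - q) * (real t * tie_prob q t (Suc (Suc k))) +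
        tie_prob q (Suc t) (Suc k)) sums (q * e k + (1 - q) * e (Suc (Suc k)) + ?r ^ Suc k)"
    proof (intro sums_add sums_mult e)
      show "(\<lambda>t. tie_prob q (Suc t) (Suc k)) sums ?r ^ Suc k"
        using tie_prob_sums[OF q, of "Suc k"] by (subst sums_Suc_iff) simp
    qed
    then have "(\<lambda>t. real (Suc t) * tie_prob q (Suc t) (Suc k)) sums
      (q * e k + (1 - q) * e (Suc (Suc k)) + ?r ^ Suc k)"
      by (simp add: algebra_simps)
    then show ?thesis
      using e(1)[of "Suc k"] sums_shift_first_zero[of "\<lambda>t. real t * tie_prob q t (Suc k)"]
      by (auto dest: sums_unique2)
  qed
  have r: "0 < ?r" "?r < 1" using q by auto
  \<comment> \<open>The source terms cancel in the difference, which therefore satisfies the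
    homogeneous recursion.\<close>
  have "real k * ?r ^ k / ?d - e k = 0"
  proof (rule harmonic_vanishing[OF q, of "\<lambda>k. real k * ?r ^ k / ?d - e k"])
    fix k
    show "real (Suc k) * ?r ^ Suc k / ?d - e (Suc k) =
      q * (real k * ?r ^ k / ?d - e k) + (1 - q) * (real (Suc (Suc k)) * ?r ^ Suc (Suc k) / ?d - e (Suc (Suc k)))"
      unfolding rec[of k] weighted_odds_power[OF q(2), of k, symmetric]
      by (simp only: right_diff_distrib)
  next
    have "(\<lambda>k. real k * ?r ^ k / ?d) \<longlonglongrightarrow> 0 / ?d"
      using r q by (intro tendsto_divide tendsto_const powser_times_n_limit_0) auto
    then have "(\<lambda>k. real k * ?r ^ k / ?d) \<longlonglongrightarrow> 0" by simp
    then show "(\<lambda>k. real k * ?r ^ k / ?d - e k) \<longlonglongrightarrow> 0"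
      by (rule tendsto_zero_remainder) (rule e(2,3))+
  qed (use e(2,3)[of 0] in simp)
  then show ?thesis using e(1)[of k] by simp
qed

subsection \<open>The conditional expectation as a finite sum\<close>

lemma sets_goal_spaceI:
  assumes "Measurable.pred goal_algebra P"
  shows "{\<omega>. P \<omega>} \<in> sets (goal_space q)"
  using assms unfolding sets_goal_space by (simp add: pred_def space_PiM)

lemma emeasure_first_goal:
  assumes q: "0 \<le> q" "q \<le> 1" and P [measurable]: "Measurable.pred goal_algebra P"
    and P': "\<And>b. Measurable.pred goal_algebra (P' b)"
    and eq: "\<And>b \<omega>. P (case_nat b \<omega>) \<longleftrightarrow> P' b \<omega>"
  shows "emeasure (goal_space q) {\<omega>. P \<omega>} =
    ennreal q * emeasure (goal_space q) {\<omega>. P' True \<omega>} +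
    ennreal (1 - q) * emeasure (goal_space q) {\<omega>. P' False \<omega>}"
proof -
  have "indicator {\<omega>. P \<omega>} (case_nat b \<omega>) = (indicator {\<omega>. P' b \<omega>} \<omega> :: ennreal)" for b \<omega>
    by (simp add: indicator_def eq)
  moreover have "indicator {\<omega>. P \<omega>} \<in> borel_measurable goal_algebra"
    using P by (intro borel_measurable_indicator) (simp add: pred_def space_PiM)
  ultimately show ?thesis
    using nn_integral_first_goal[OF q, of "indicator {\<omega>. P \<omega>}"]
    by (simp only: nn_integral_indicator[OF sets_goal_spaceI] P P')
qed

lemma emeasure_first_tie:
  assumes q: "0 \<le> q" "q \<le> 1"
  shows "emeasure (goal_space q) {\<omega>. first_tie k t \<omega>} = ennreal (tie_prob q t k)"
proof (induction t arbitrary: k)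
  case 0
  interpret prob_space "goal_space q" by (rule prob_space_goal_space)
  show ?case using emeasure_space_1 by (simp add: first_tie_simps)
next
  case (Suc t)
  show ?case
  proof (cases k)
    case (Suc j)
    have "emeasure (goal_space q) {\<omega>. first_tie k (Suc t) \<omega>} =
      ennreal q * emeasure (goal_space q) {\<omega>. first_tie j t \<omega>} +
      ennreal (1 - q) * emeasure (goal_space q) {\<omega>. first_tie (Suc (Suc j)) t \<omega>}"
      by (rule emeasure_first_goal[OF q, where P' = "\<lambda>b. first_tie (if b then j else Suc (Suc j)) t",
            simplified if_True if_False])
        (auto simp only: Suc first_tie_simps intro: measurable_first_tie)
    also have "\<dots> = ennreal (tie_prob q (Suc t) k)"
      using q by (simp add: Suc Suc.IH tie_prob_nonneg flip: ennreal_mult' ennreal_plus)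
    finally show ?thesis .
  qed (simp add: first_tie_simps)
qed

lemma nn_integral_at_tie:
  assumes q: "0 \<le> q" "q \<le> 1" and \<gamma>: "\<And>t. 0 \<le> \<gamma> t"
    and sums: "(\<lambda>t. \<gamma> t * tie_prob q t k) sums x"
  shows "(\<integral>\<^sup>+\<omega>. at_tie (\<lambda>t. ennreal (\<gamma> t)) k \<omega> \<partial>goal_space q) = ennreal x"
proof -
  have [measurable]: "{\<omega>. first_tie k t \<omega>} \<in> sets (goal_space q)" for t
    by (rule sets_goal_spaceI) (rule measurable_first_tie)
  have "(\<integral>\<^sup>+\<omega>. at_tie (\<lambda>t. ennreal (\<gamma> t)) k \<omega> \<partial>goal_space q) =
    (\<Sum>t. \<integral>\<^sup>+\<omega>. ennreal (\<gamma> t) * indicator {\<omega>. first_tie k t \<omega>} \<omega> \<partial>goal_space q)"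
    unfolding at_tie_def by (rule nn_integral_suminf) measurable
  also have "\<dots> = (\<Sum>t. ennreal (\<gamma> t * tie_prob q t k))"
    using \<gamma> by (simp add: nn_integral_cmult_indicator emeasure_first_tie q ennreal_mult')
  also have "\<dots> = ennreal x"
    using sums by (intro suminf_ennreal_eq mult_nonneg_nonneg \<gamma> tie_prob_nonneg q)
  finally show ?thesis .
qed

text \<open>The failure probability \<open>x g\<close> satisfies
  \<open>x (g + 1) = q * x (g + 1) + (1 - q) * x g\<close>; if \<open>x g = 0\<close>, then
  \<open>q < 1\<close> forces \<open>x (g + 1) = 0\<close>.\<close>

lemma AE_reaches:
  assumes q: "0 \<le> q" "q < 1"
  shows "AE \<omega> in goal_space q. reaches g \<omega>"
proof -
  interpret prob_space "goal_space q" by (rule prob_space_goal_space)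
  have "emeasure (goal_space q) {\<omega>. \<not> reaches g \<omega>} = 0"
  proof (induction g)
    case (Suc g)
    have "emeasure (goal_space q) {\<omega>. \<not> reaches (Suc g) \<omega>} =
      ennreal q * emeasure (goal_space q) {\<omega>. \<not> reaches (Suc g) \<omega>} +
      ennreal (1 - q) * emeasure (goal_space q) {\<omega>. \<not> reaches g \<omega>}"
    proof (rule emeasure_first_goal[where P' = "\<lambda>b \<omega>. \<not> reaches (if b then Suc g else g) \<omega>",
          simplified if_True if_False])
      show "Measurable.pred goal_algebra (\<lambda>\<omega>. \<not> reaches (if b then Suc g else g) \<omega>)" for b
        by (cases b) measurable
    qed (use q in \<open>simp_all only: reaches_case_nat\<close>, measurable)
    then have "prob {\<omega>. \<not> reaches (Suc g) \<omega>} = q * prob {\<omega>. \<not> reaches (Suc g) \<omega>}"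
      unfolding Suc unfolding emeasure_eq_measure using q by (simp flip: ennreal_mult')
    then have "prob {\<omega>. \<not> reaches (Suc g) \<omega>} = 0" using q by simp
    then show ?case by (simp add: emeasure_eq_measure)
  qed simp
  moreover have "{\<omega>. \<not> reaches g \<omega>} \<in> sets (goal_space q)"
    by (rule sets_goal_spaceI) measurable
  ultimately show ?thesis by (intro AE_I[of _ _ "{\<omega>. \<not> reaches g \<omega>}"]) auto
qed

text \<open>
  Conditioning on the first goal gives the same recursion in \<open>(g, s)\<close> for the expected payoff and
  for \<^const>\<open>negbin_sum\<close>; on the boundary \<open>g = 0\<close> only Phase II is left.
\<close>

lemma nn_integral_phase2_payoff:
  assumes q: "0 \<le> q" "q < 1" and \<phi>: "\<And>k. 0 \<le> \<phi> k"
    and tie: "\<And>k. (\<integral>\<^sup>+\<omega>. at_tie c k \<omega> \<partial>goal_space q) = ennreal (\<phi> k)"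
  shows "(\<integral>\<^sup>+\<omega>. phase2_payoff c g s \<omega> \<partial>goal_space q) =
      ennreal (\<phi> 0 + negbin_sum (1 - q) q (\<lambda>j. \<phi> j - \<phi> 0) g s) \<and>
    0 \<le> \<phi> 0 + negbin_sum (1 - q) q (\<lambda>j. \<phi> j - \<phi> 0) g s"
proof (induction "g + s" arbitrary: g s rule: less_induct)
  case less
  \<comment> \<open>All scores of at least \<open>s\<close> give \<open>\<phi> 0\<close>. Taking
    this as the base value and summing only differences keeps the sum finite.\<close>
  let ?V = "\<lambda>g s. \<phi> 0 + negbin_sum (1 - q) q (\<lambda>j. \<phi> j - \<phi> 0) g s"
  interpret prob_space "goal_space q" by (rule prob_space_goal_space)
  consider "s = 0" | s' where "g = 0" "s = Suc s'" | g' s' where "g = Suc g'" "s = Suc s'"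
    by (metis not0_implies_Suc)
  then show ?case
  proof cases
    case 1
    have "c 0 = ennreal (\<phi> 0)" using tie[of 0] emeasure_space_1 by simp
    moreover have "phase2_payoff c g s = (\<lambda>_. c 0)" using 1 by (simp add: fun_eq_iff)
    ultimately show ?thesis using 1 \<phi> emeasure_space_1 by simp
  next
    case 2
    then have "phase2_payoff c g s = at_tie c s" by (simp add: fun_eq_iff)
    with 2 tie[of s] \<phi>[of s] show ?thesis by simp
  next
    case 3
    have IH: "(\<integral>\<^sup>+\<omega>. phase2_payoff c (Suc g') s' \<omega> \<partial>goal_space q) = ennreal (?V (Suc g') s')"
      "0 \<le> ?V (Suc g') s'"
      "(\<integral>\<^sup>+\<omega>. phase2_payoff c g' (Suc s') \<omega> \<partial>goal_space q) = ennreal (?V g' (Suc s'))"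
      "0 \<le> ?V g' (Suc s')"
      using less[of "Suc g'" s'] less[of g' "Suc s'"] 3 by auto
    have V: "?V g s = q * ?V (Suc g') s' + (1 - q) * ?V g' (Suc s')"
      unfolding 3 negbin_sum_Suc_Suc by (simp add: algebra_simps)
    have "(\<integral>\<^sup>+\<omega>. phase2_payoff c g s \<omega> \<partial>goal_space q) =
      ennreal q * (\<integral>\<^sup>+\<omega>. phase2_payoff c g s (case_nat True \<omega>) \<partial>goal_space q) +
      ennreal (1 - q) * (\<integral>\<^sup>+\<omega>. phase2_payoff c g s (case_nat False \<omega>) \<partial>goal_space q)"
      using q by (intro nn_integral_first_goal) auto
    also have "(\<integral>\<^sup>+\<omega>. phase2_payoff c g s (case_nat True \<omega>) \<partial>goal_space q) =
      (\<integral>\<^sup>+\<omega>. phase2_payoff c (Suc g') s' \<omega> \<partial>goal_space q)"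
      \<comment> \<open>The pointwise decomposition of the payoff requires Phase I to end, which
        holds outside a null set.\<close>
      using AE_reaches[OF q, of "Suc g'"]
      by (intro nn_integral_cong_AE, eventually_elim) (simp add: 3 phase2_payoff_case_nat)
    also have "(\<integral>\<^sup>+\<omega>. phase2_payoff c g s (case_nat False \<omega>) \<partial>goal_space q) =
      (\<integral>\<^sup>+\<omega>. phase2_payoff c g' (Suc s') \<omega> \<partial>goal_space q)"
      using AE_reaches[OF q, of g']
      by (intro nn_integral_cong_AE, eventually_elim) (simp add: 3 phase2_payoff_case_nat)
    finally have "(\<integral>\<^sup>+\<omega>. phase2_payoff c g s \<omega> \<partial>goal_space q) = ennreal (?V g s)"
      unfolding V IH using q IH(2,4)
      by (simp add: ennreal_mult' ennreal_plus)
    moreover have "0 \<le> ?V g s" unfolding V using q IH(2,4) by simp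
    ultimately show ?thesis by blast
  qed
qed

lemma race_prob_pos:
  assumes "0 < q" "q < 1" "0 < n"
  shows "0 < race_prob q n"
proof -
  have "(\<Sum>m\<in>{0}. real (n + m - 1 choose m) * q ^ n * (1 - q) ^ m * 1) \<le> race_prob q n"
    unfolding race_prob_def negbin_sum_def using assms by (intro sum_mono2) auto
  then show ?thesis using assms by simp (meson order_less_le_trans zero_less_power)
qed

lemma cond_expected_duration_eq:
  assumes q: "0 < q" "q < 1 / 2" and n: "0 < n"
  shows "cond_expected_duration n q =
    negbin_sum q (1 - q) real n n / (2 * (1 - 2 * q) * race_prob q n)"
proof -
  let ?M = "goal_space q" and ?W = "{\<omega> \<in> space (goal_space q). B_wins n \<omega>}"
  have W: "?W \<in> sets ?M" by measurable
  have payoff: "(\<integral>\<^sup>+\<omega>. ennreal (\<gamma> (phase2_duration n \<omega>)) * indicator ?W \<omega> \<partial>?M) =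
      ennreal (\<phi> 0 + negbin_sum (1 - q) q (\<lambda>j. \<phi> j - \<phi> 0) n n)"
    if "\<And>t. 0 \<le> \<gamma> t" "\<And>k. 0 \<le> \<phi> k" "\<And>k. (\<lambda>t. \<gamma> t * tie_prob q t k) sums \<phi> k" for \<gamma> \<phi>
  proof -
    have "(\<integral>\<^sup>+\<omega>. ennreal (\<gamma> (phase2_duration n \<omega>)) * indicator ?W \<omega> \<partial>?M) =
      (\<integral>\<^sup>+\<omega>. phase2_payoff (\<lambda>t. ennreal (\<gamma> t)) n n \<omega> \<partial>?M)"
      using AE_reaches[of q n] q
      by (intro nn_integral_cong_AE) (auto simp: phase2_payoff_diag elim!: eventually_mono)
    then show ?thesis
      using that q by (simp add: nn_integral_phase2_payoff nn_integral_at_tie)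
  qed
  have "emeasure ?M ?W = (\<integral>\<^sup>+\<omega>. ennreal 1 * indicator ?W \<omega> \<partial>?M)"
    using W by simp
  also have "\<dots> = ennreal (1 + negbin_sum (1 - q) q (\<lambda>j. (q / (1 - q)) ^ j - 1) n n)"
    using payoff[of "\<lambda>_. 1" "\<lambda>k. (q / (1 - q)) ^ k"] tie_prob_sums[OF q] q by simp
  also have "negbin_sum (1 - q) q (\<lambda>j. (q / (1 - q)) ^ j - 1) n n =
    negbin_sum (1 - q) q (\<lambda>j. (q / (1 - q)) ^ j * 1) n n - race_prob (1 - q) n"
    by (simp add: race_prob_def negbin_sum_def sum_subtractf algebra_simps)
  \<comment> \<open>B is level or ahead after Phase I with probability
    \<open>1 - race_prob (1 - q) n = race_prob q n\<close>; by the tilt, comebacks in Phase II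
    contribute the same amount.\<close>
  also have "1 + \<dots> = 2 * race_prob q n"
    using negbin_sum_tilt[of "1 - q" q "\<lambda>_. 1" n] race_prob_complement[OF n, of q] q
    by (simp add: race_prob_def)
  finally have win: "emeasure ?M ?W = ennreal (2 * race_prob q n)" .
  have "(\<integral>\<^sup>+\<omega>. ennreal (real (phase2_duration n \<omega>)) * indicator ?W \<omega> \<partial>?M) =
      ennreal (negbin_sum (1 - q) q (\<lambda>j. real j * (q / (1 - q)) ^ j / (1 - 2 * q)) n n)"
    \<comment> \<open>Here \<open>\<phi> 0 = 0\<close>, so no constant term remains.\<close>
    using payoff[of real "\<lambda>k. real k * (q / (1 - q)) ^ k / (1 - 2 * q)"] weighted_tie_prob_sums[OF q] q
    by simp
  also have "negbin_sum (1 - q) q (\<lambda>j. real j * (q / (1 - q)) ^ j / (1 - 2 * q)) n n =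
    negbin_sum (1 - q) q (\<lambda>j. (q / (1 - q)) ^ j * real j) n n / (1 - 2 * q)"
    by (simp add: negbin_sum_def sum_divide_distrib mult_ac)
  also have "\<dots> = negbin_sum q (1 - q) real n n / (1 - 2 * q)"
    using negbin_sum_tilt[of "1 - q" q real n] q by simp
  finally have dur: "(\<integral>\<^sup>+\<omega>. ennreal (real (phase2_duration n \<omega>)) * indicator ?W \<omega> \<partial>?M) =
    ennreal (negbin_sum q (1 - q) real n n / (1 - 2 * q))" .
  have dur_measurable: "(\<lambda>\<omega>. real (phase2_duration n \<omega>)) \<in> borel_measurable ?M" by measurable
  have L: "0 < race_prob q n" using race_prob_pos q n by simp
  have Z: "0 \<le> negbin_sum q (1 - q) real n n" using q by (intro negbin_sum_nonneg) auto
  have "cond_expected_duration n q =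
    enn2real (\<integral>\<^sup>+\<omega>. ennreal (real (phase2_duration n \<omega>)) \<partial>uniform_measure ?M ?W)"
    unfolding cond_expected_duration_def using dur_measurable by (intro integral_eq_nn_integral) simp_all
  also have "(\<integral>\<^sup>+\<omega>. ennreal (real (phase2_duration n \<omega>)) \<partial>uniform_measure ?M ?W) =
    ennreal (negbin_sum q (1 - q) real n n / (1 - 2 * q)) / ennreal (2 * race_prob q n)"
    unfolding win[symmetric] dur[symmetric] by (rule nn_integral_uniform_measure) (measurable)
  also have "\<dots> = ennreal (negbin_sum q (1 - q) real n n / (1 - 2 * q) / (2 * race_prob q n))"
    using L Z q by (intro divide_ennreal) auto
  finally show ?thesis using L Z q by (simp add: mult_ac)
qed

subsection \<open>Asymptotic expansion\<close>

lemma tendsto_zero_antimono_nonneg: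
  fixes X :: "nat \<Rightarrow> real"
  assumes "\<And>n. N \<le> n \<Longrightarrow> X (Suc n) \<le> X n" "X \<longlonglongrightarrow> 0" "N \<le> n"
  shows "0 \<le> X n"
proof -
  have "decseq (\<lambda>k. X (k + n))" using assms by (intro decseq_SucI) simp
  then show ?thesis using decseq_ge[OF _ LIMSEQ_ignore_initial_segment[OF assms(2), of n], of 0] by simp
qed

text \<open>Comparison with \<open>\<Sum>k\<ge>n. b k * \<delta> k\<close>, which is dominated by a geometric series.\<close>

lemma geometric_tail_comparison:
  fixes b \<delta> M :: "nat \<Rightarrow> real"
  assumes y: "y < 1" and b: "\<And>n. 0 \<le> b n" "\<And>n. b (Suc n) \<le> y * b n" "b \<longlonglongrightarrow> 0"
    and \<delta>: "\<And>n. 0 \<le> \<delta> n" "\<And>n. N \<le> n \<Longrightarrow> \<delta> (Suc n) \<le> \<delta> n"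
    and M: "\<And>n. N \<le> n \<Longrightarrow> \<bar>M n - M (Suc n)\<bar> \<le> b n * \<delta> n" "M \<longlonglongrightarrow> 0"
    and n: "N \<le> n"
  shows "\<bar>M n\<bar> \<le> b n * \<delta> n / (1 - y)"
proof -
  define B where "B n = b n * \<delta> n / (1 - y)" for n
  \<comment> \<open>As \<open>1 / (1 - y)\<close> sums the geometric series, one step lowers
    \<open>B\<close> by at least the allowed error \<open>b n * \<delta> n\<close>.\<close>
  have B: "B (Suc n) + b n * \<delta> n \<le> B n" if "N \<le> n" for n
  proof -
    have "b (Suc n) * \<delta> (Suc n) \<le> (y * b n) * \<delta> n"
      by (intro mult_mono b \<delta> that order_trans[OF b(1) b(2)])
    then have "(b (Suc n) * \<delta> (Suc n) + (1 - y) * (b n * \<delta> n)) / (1 - y) \<le> b n * \<delta> n / (1 - y)"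
      using y by (intro divide_right_mono) (auto simp: algebra_simps)
    then show ?thesis using y by (simp add: B_def add_divide_distrib)
  qed
  have \<delta>N: "\<delta> n \<le> \<delta> N" if "N \<le> n" for n
    using that by (induction n rule: dec_induct) (auto intro: order_trans \<delta>)
  have "B \<longlonglongrightarrow> 0"
  proof (rule Lim_null_comparison)
    show "\<forall>\<^sub>F n in sequentially. norm (B n) \<le> b n * (\<delta> N / (1 - y))"
      using eventually_ge_at_top[of N]
    proof eventually_elim
      case (elim n)
      then have "b n * \<delta> n \<le> b n * \<delta> N" by (intro mult_left_mono b \<delta>N)
      with y show ?case by (simp add: B_def b \<delta> abs_mult divide_right_mono)
    qed
    show "(\<lambda>n. b n * (\<delta> N / (1 - y))) \<longlonglongrightarrow> 0" using tendsto_mult_left_zero[OF b(3)] .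
  qed
  \<comment> \<open>Both \<open>B - M\<close> and \<open>B + M\<close> are nonincreasing from
    \<open>N\<close> on and tend to \<open>0\<close>, hence are nonnegative there.\<close>
  then have "(\<lambda>n. B n - M n) \<longlonglongrightarrow> 0" "(\<lambda>n. B n + M n) \<longlonglongrightarrow> 0"
    using tendsto_diff[OF _ M(2), of B 0] tendsto_add[OF _ M(2), of B 0] by simp_all
  moreover have "B (Suc k) - M (Suc k) \<le> B k - M k" "B (Suc k) + M (Suc k) \<le> B k + M k"
    if "N \<le> k" for k
    using B[OF that] M(1)[OF that] by linarith+
  ultimately have "0 \<le> B n - M n" "0 \<le> B n + M n"
    using n tendsto_zero_antimono_nonneg[of N "\<lambda>n. B n - M n" n]
      tendsto_zero_antimono_nonneg[of N "\<lambda>n. B n + M n" n] by blast+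
  then show ?thesis by (simp add: B_def abs_le_iff)
qed

text \<open>
  With \<open>t = q * (1 - q)\<close> and \<open>z = 1 / ((1 - 2 * q)\<^sup>2 * n)\<close>, the claimed expansion of the expected
  duration is \<open>n / (2 * q * (1 - 2 * q)\<^sup>2) * (approx t z - (1 - 2 * q)\<^sup>2)\<close>. Passing from \<open>n\<close> to
  \<open>n + 1\<close> replaces \<open>z\<close> by \<open>z / (1 + (1 - 4 * t) * z)\<close>; \<open>approx_shift\<close> is the numerator after this
  substitution, and \<open>approx_defect\<close> is the quotient by \<open>z ^ 6\<close> of the error with which \<open>1 / approx\<close>
  satisfies the recurrence of \<open>U\<close>.
\<close>

definition approx :: "real \<Rightarrow> real \<Rightarrow> real" where
  "approx t z = (1 - 4 * t) * (1 + 2 * t * (z - z ^ 2 + (6 * t + 1) * z ^ 3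
     - (36 * t ^ 2 + 24 * t + 1) * z ^ 4 + (216 * t ^ 3 + 372 * t ^ 2 + 66 * t + 1) * z ^ 5))"

definition approx_shift :: "real \<Rightarrow> real \<Rightarrow> real" where
  "approx_shift t z = (let a = 1 + (1 - 4 * t) * z in
     (1 - 4 * t) * (a ^ 5 + 2 * t * (z * a ^ 4 - z ^ 2 * a ^ 3 + (6 * t + 1) * z ^ 3 * a ^ 2
     - (36 * t ^ 2 + 24 * t + 1) * z ^ 4 * a + (216 * t ^ 3 + 372 * t ^ 2 + 66 * t + 1) * z ^ 5)))"

definition approx_defect :: "real \<Rightarrow> real \<Rightarrow> real" where
  "approx_defect t z =
     (- (2 * t) - 296 * t ^ 2 - 1856 * t ^ 3 + 19968 * t ^ 4 + 5088 * t ^ 5 - 132864 * t ^ 6 - 41472 * t ^ 7) +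
     (- (8 * t) - 824 * t ^ 2 + 2848 * t ^ 3 + 48192 * t ^ 4 - 259200 * t ^ 5 + 135168 * t ^ 6 + 669696 * t ^ 7) * z +
     (- (12 * t) - 924 * t ^ 2 + 8784 * t ^ 3 + 12192 * t ^ 4 - 394944 * t ^ 5 + 1439808 * t ^ 6 - 904704 * t ^ 7 - 2276352 * t ^ 8) * z ^ 2 +
     (- (8 * t) - 452 * t ^ 2 + 7952 * t ^ 3 - 16256 * t ^ 4 - 166400 * t ^ 5 + 1125312 * t ^ 6 - 3680256 * t ^ 7 + 3984384 * t ^ 8 + 5529600 * t ^ 9) * z ^ 3 +
     (- (2 * t) - 84 * t ^ 2 + 1720 * t ^ 3 - 26096 * t ^ 4 - 59296 * t ^ 5 + 812224 * t ^ 6 + 243072 * t ^ 7 - 805632 * t ^ 8 - 14045184 * t ^ 9 - 8957952 * t ^ 10) * z ^ 4"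

lemma approx_shift:
  assumes "1 + (1 - 4 * t) * z \<noteq> 0"
  shows "approx t (z / (1 + (1 - 4 * t) * z)) = approx_shift t z / (1 + (1 - 4 * t) * z) ^ 5"
proof -
  define a where "a = 1 + (1 - 4 * t) * z"
  have [simp]: "a \<noteq> 0" using assms by (simp add: a_def)
  show ?thesis
    unfolding approx_def approx_shift_def Let_def a_def[symmetric]
    by (simp add: power_divide divide_simps) (simp add: eval_nat_numeral algebra_simps)
qed

text \<open>The recurrence cleared of denominators, as a polynomial identity: the coefficients of
  \<open>approx\<close> make all powers of \<open>z\<close> below the sixth cancel.\<close>

lemma approx_defect:
  "approx_shift t z * (1 - approx t z) -
     2 * t * (2 + (1 - 4 * t) * z) * (1 + (1 - 4 * t) * z) ^ 4 * approx t z = z ^ 6 * approx_defect t z"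
  unfolding approx_def approx_shift_def Let_def approx_defect_def by algebra

text \<open>For \<open>z = 1 / ((1 - 4 * t) * n)\<close> the shifted argument belongs to
  \<open>n + 1\<close>, and the factor in front is \<open>2 * t * (2 * n + 1) / (n + 1)\<close>, as
  in the recurrence of \<open>U\<close>.\<close>

lemma approx_recurrence:
  assumes "1 + (1 - 4 * t) * z \<noteq> 0" "approx t z \<noteq> 0" "approx_shift t z \<noteq> 0"
  shows "1 / approx t z - 1 - 2 * t * (2 + (1 - 4 * t) * z) / (1 + (1 - 4 * t) * z) *
      (1 / approx t (z / (1 + (1 - 4 * t) * z))) =
    z ^ 6 * (approx_defect t z / (approx t z * approx_shift t z))"
proof -
  define a where "a = 1 + (1 - 4 * t) * z"
  define v where "v = approx t z"
  define W where "W = approx_shift t z"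
  define k where "k = 2 * t * (2 + (1 - 4 * t) * z)"
  have nz: "a \<noteq> 0" "v \<noteq> 0" "W \<noteq> 0" using assms by (simp_all add: a_def v_def W_def)
  have shift: "approx t (z / a) = W / a ^ 5"
    using approx_shift[of t z] assms by (simp add: a_def W_def)
  have "1 / v - 1 - k / a * (1 / approx t (z / a)) = (W * (1 - v) - k * a ^ 4 * v) / (v * W)"
    unfolding shift using nz by (simp add: field_simps eval_nat_numeral)
  also have "W * (1 - v) - k * a ^ 4 * v = z ^ 6 * approx_defect t z"
    unfolding W_def v_def k_def a_def by (rule approx_defect)
  finally show ?thesis by (simp add: a_def v_def W_def k_def)
qed

section \<open>Decay of the central binomial terms and of the race probability\<close>

definition central_term :: "real \<Rightarrow> nat \<Rightarrow> real" where
  "central_term t n = real (2 * n choose n) * t ^ n"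

lemma central_term_pos: "0 < t \<Longrightarrow> 0 < central_term t n"
  by (simp add: central_term_def)

lemma central_term_Suc:
  "central_term t (Suc n) = 2 * t * (2 * real n + 1) / (real n + 1) * central_term t n"
proof -
  have "real (2 * Suc n choose Suc n) = 2 * (2 * real n + 1) / (real n + 1) * real (2 * n choose n)"
    using central_binomial_Suc[of n] by (simp add: field_simps del: binomial_Suc_Suc mult_Suc_right)
  then show ?thesis
    by (simp add: central_term_def del: binomial_Suc_Suc mult_Suc_right)
qed

lemma central_term_Suc_le:
  assumes "0 \<le> t"
  shows "central_term t (Suc n) \<le> 4 * t * central_term t n"
proof -
  have "2 * t * (2 * real n + 1) / (real n + 1) \<le> 4 * t"
    using assms by (simp add: field_simps)
  then show ?thesis
    unfolding central_term_Suc using assms by (intro mult_right_mono) (auto simp: central_term_def)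
qed

lemma central_term_tendsto_0:
  assumes "0 \<le> t" "t < 1 / 4"
  shows "central_term t \<longlonglongrightarrow> 0"
proof (rule Lim_null_comparison[OF always_eventually])
  show "\<forall>n. norm (central_term t n) \<le> (4 * t) ^ n"
  proof
    fix n
    have "central_term t n \<le> (4 * t) ^ n"
    proof (induction n)
      case (Suc n)
      have "central_term t (Suc n) \<le> 4 * t * central_term t n" by (rule central_term_Suc_le[OF assms(1)])
      also have "\<dots> \<le> 4 * t * (4 * t) ^ n" using Suc assms by (intro mult_left_mono) auto
      finally show ?case by simp
    qed (simp add: central_term_def)
    then show "norm (central_term t n) \<le> (4 * t) ^ n" using assms by (simp add: central_term_def)
  qed
  show "(\<lambda>n. (4 * t) ^ n) \<longlonglongrightarrow> 0" using assms by (intro LIMSEQ_realpow_zero) auto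
qed

lemma race_prob_tendsto_0:
  assumes "0 < q" "q < 1 / 2"
  shows "race_prob q \<longlonglongrightarrow> 0"
proof (rule Lim_null_comparison)
  show "\<forall>\<^sub>F n in sequentially. norm (race_prob q n) \<le> (4 * (q * (1 - q))) ^ n * (1 / 2)"
    using eventually_gt_at_top[of 0]
  proof eventually_elim
    case (elim n)
    then show ?case using race_prob_le[of q n] race_prob_nonneg[of q n] assms by simp
  qed
  have "0 < (1 - 2 * q) ^ 2" using assms by (intro zero_less_power) simp
  then have "4 * (q * (1 - q)) < 1" by (simp add: power2_eq_square algebra_simps)
  then have "(\<lambda>n. (4 * (q * (1 - q))) ^ n) \<longlonglongrightarrow> 0" using assms by (intro LIMSEQ_realpow_zero) auto
  then show "(\<lambda>n. (4 * (q * (1 - q))) ^ n * (1 / 2)) \<longlonglongrightarrow> 0" by (rule tendsto_mult_left_zero)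
qed

lemma cond_expected_duration_closed_form:
  assumes q: "0 < q" "q < 1 / 2" and n: "0 < n"
  shows "cond_expected_duration n q = real n / (2 * q * (1 - 2 * q) ^ 2) *
    ((1 - 2 * q) * central_term (q * (1 - q)) n / (2 * race_prob q n) - (1 - 2 * q) ^ 2)"
proof -
  have L: "0 < race_prob q n" using race_prob_pos q n by simp
  have d: "0 < 1 - 2 * q" using q by simp
  define Z where "Z = negbin_sum q (1 - q) real n n"
  define l where "l = race_prob q n"
  define c where "c = central_term (q * (1 - q)) n"
  define d where "d = 1 - 2 * q"
  have pos: "0 < l" "0 < d" using L d by (simp_all add: l_def d_def)
  have "q * Z = real n * (c / 2 - d * l)"
    unfolding Z_def c_def d_def l_def central_term_def by (rule negbin_sum_id_diag[OF n])
  then have Z: "Z = real n * (c / 2 - d * l) / q" using q by (simp add: field_simps)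
  have "cond_expected_duration n q = Z / (2 * d * l)"
    unfolding Z_def l_def d_def using q n by (rule cond_expected_duration_eq)
  also have "\<dots> = real n / (2 * q * d ^ 2) * (d * c / (2 * l) - d ^ 2)"
    unfolding Z using q pos by (simp add: field_simps power2_eq_square)
  finally show ?thesis by (simp add: d_def l_def c_def)
qed

text \<open>The coefficients are symmetric under exchanging \<open>q\<close> and
  \<open>1 - q\<close>, hence polynomials in \<open>t\<close>. The constant term of
  \<open>approx\<close> cancels, and \<open>n * z = 1 / e\<close> turns the prefactor into
  \<open>(1 - q) / e\<close>.\<close>

lemma expansion_eq_approx:
  assumes q: "0 < q" "q < 1 / 2" and n: "0 < n"
  shows "(1 - q) / (1 - 2 * q) ^ 2 *
       (1 - 1 / (1 - 2 * q) ^ 2 * (1 / real n)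
          - (6 * q ^ 2 - 6 * q - 1) / (1 - 2 * q) ^ 4 * (1 / real n ^ 2)
          - (36 * q ^ 4 - 72 * q ^ 3 + 12 * q ^ 2 + 24 * q + 1) / (1 - 2 * q) ^ 6
              * (1 / real n ^ 3)
          - (216 * q ^ 6 - 648 * q ^ 5 + 276 * q ^ 4 + 528 * q ^ 3 - 306 * q ^ 2 - 66 * q - 1)
              / (1 - 2 * q) ^ 8 * (1 / real n ^ 4)) =
    real n / (2 * q * (1 - 2 * q) ^ 2) *
      (approx (q * (1 - q)) (1 / ((1 - 2 * q) ^ 2 * real n)) - (1 - 2 * q) ^ 2)"
proof -
  define e where "e = (1 - 2 * q) ^ 2"
  define z where "z = 1 / (e * real n)"
  define t where "t = q * (1 - q)"
  define A where "A = 6 * t + 1"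
  define B where "B = 36 * t ^ 2 + 24 * t + 1"
  define C where "C = 216 * t ^ 3 + 372 * t ^ 2 + 66 * t + 1"
  have "0 < e" unfolding e_def using q by (intro zero_less_power) simp
  moreover have "1 - 4 * t = e" by (simp add: e_def t_def power2_eq_square algebra_simps)
  ultimately have e: "0 < e" "1 - 4 * t = e" by blast+
  have coeffs: "6 * q ^ 2 - 6 * q - 1 = - A"
    "36 * q ^ 4 - 72 * q ^ 3 + 12 * q ^ 2 + 24 * q + 1 = B"
    "216 * q ^ 6 - 648 * q ^ 5 + 276 * q ^ 4 + 528 * q ^ 3 - 306 * q ^ 2 - 66 * q - 1 = - C"
    unfolding A_def B_def C_def t_def by algebra+
  have pows: "(1 - 2 * q) ^ 4 = e ^ 2" "(1 - 2 * q) ^ 6 = e ^ 3" "(1 - 2 * q) ^ 8 = e ^ 4"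
    unfolding e_def by (simp_all flip: power_mult)
  have nz: "real n * z = 1 / e" using n e by (simp add: z_def)
  have zs: "1 / e * (1 / real n) = z" "x / e ^ k * (1 / real n ^ k) = x * z ^ k" for x k
    using n e by (simp_all add: z_def power_divide power_mult_distrib)
  have "real n / (2 * q * e) * (approx t z - e) =
    (1 - q) * (real n * z) * (1 - z + A * z ^ 2 - B * z ^ 3 + C * z ^ 4)"
    unfolding approx_def e(2) A_def[symmetric] B_def[symmetric] C_def[symmetric]
    using q e by (simp add: t_def field_simps eval_nat_numeral)
  also have "\<dots> = (1 - q) / e * (1 - z + A * z ^ 2 - B * z ^ 3 + C * z ^ 4)"
    unfolding nz by simp
  finally show ?thesis
    unfolding coeffs pows unfolding e_def[symmetric] t_def[symmetric] z_def[symmetric] zs by simp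
qed

lemma duration_expansion_bound:
  fixes q :: real
  assumes q: "0 < q" "q < 1 / 2"
  defines "e \<equiv> (1 - 2 * q) ^ 2" and "t \<equiv> q * (1 - q)"
  shows "(\<lambda>n. cond_expected_duration n q -
    real n / (2 * q * e) * (approx t (1 / (e * real n)) - e)) \<in> O(\<lambda>n. 1 / real n ^ 5)"
proof -
  define d where "d = 1 - 2 * q"
  have d: "0 < d" "e = d ^ 2" using q by (simp_all add: d_def e_def)
  have e: "0 < e" unfolding e_def using q by (intro zero_less_power) simp
  have t: "0 < t" unfolding t_def using q by simp
  have et: "1 - 4 * t = e" by (simp add: e_def t_def power2_eq_square algebra_simps)
  define z where "z n = 1 / (e * real n)" for n
  define b where "b = central_term t"
  define v where "v = approx t"
  define W where "W = approx_shift t"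
  \<comment> \<open>This is \<open>b n * (U n - 1 / v (z n))\<close>: the weight \<open>b n\<close>
    turns the recurrence of \<open>U\<close> into a plain difference equation.\<close>
  define M where "M n = 2 * race_prob q n / d - b n / v (z n)" for n
  have b: "0 < b n" for n unfolding b_def using t by (rule central_term_pos)
  have z0: "z \<longlonglongrightarrow> 0"
  proof -
    have "(\<lambda>n. 1 / e * (1 / real n)) \<longlonglongrightarrow> 1 / e * 0" by (intro tendsto_mult tendsto_const lim_1_over_n)
    then show ?thesis by (simp add: z_def[abs_def])
  qed
  have at0: "v 0 = e" "W 0 = e" by (simp_all add: v_def W_def approx_def approx_shift_def et)
  have "isCont v 0" "isCont W 0" "isCont (approx_defect t) 0"
    unfolding v_def W_def approx_def approx_shift_def approx_defect_def Let_def by (intro continuous_intros)+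
  then have lims: "(\<lambda>n. v (z n)) \<longlonglongrightarrow> e" "(\<lambda>n. W (z n)) \<longlonglongrightarrow> e"
    "(\<lambda>n. approx_defect t (z n)) \<longlonglongrightarrow> approx_defect t 0"
    using isCont_tendsto_compose[OF _ z0] at0 by metis+
  \<comment> \<open>One more than the limit, so that \<open>K\<close> eventually bounds the
    normalised defect.\<close>
  define K where "K = \<bar>approx_defect t 0 / (e * e)\<bar> + 1"
  have "(\<lambda>n. \<bar>approx_defect t (z n) / (v (z n) * W (z n))\<bar>) \<longlonglongrightarrow> \<bar>approx_defect t 0 / (e * e)\<bar>"
    using e by (intro tendsto_intros lims) auto
  then have "\<forall>\<^sub>F n in sequentially. \<bar>approx_defect t (z n) / (v (z n) * W (z n))\<bar> < K"
    by (rule order_tendstoD) (simp add: K_def)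
  moreover have "\<forall>\<^sub>F n in sequentially. 0 < v (z n)" "\<forall>\<^sub>F n in sequentially. 0 < W (z n)"
    "\<forall>\<^sub>F n in sequentially. v (z n) < e + 1"
    using lims e by (auto intro: order_tendstoD)
  ultimately have "\<forall>\<^sub>F n in sequentially. 0 < n \<and> 0 < v (z n) \<and> 0 < W (z n) \<and> v (z n) < e + 1 \<and>
    \<bar>approx_defect t (z n) / (v (z n) * W (z n))\<bar> < K"
    using eventually_gt_at_top[of 0] by eventually_elim blast
  then obtain N where N: "\<And>n. N \<le> n \<Longrightarrow> 0 < n \<and> 0 < v (z n) \<and> 0 < W (z n) \<and> v (z n) < e + 1 \<and>
    \<bar>approx_defect t (z n) / (v (z n) * W (z n))\<bar> < K"
    unfolding eventually_sequentially by blast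
  have step: "M n - M (Suc n) = - (b n * (z n ^ 6 * (approx_defect t (z n) / (v (z n) * W (z n)))))"
    if n: "N \<le> n" for n
  proof -
    define a where "a = 1 + e * z n"
    have n0: "0 < n" using N[OF n] by blast
    have a: "a = (real n + 1) / real n" using n0 e by (simp add: a_def z_def field_simps)
    have za: "z n / a = z (Suc n)" unfolding a using n0 e by (simp add: z_def field_simps)
    have "2 * t * (2 + e * z n) / a = 2 * t * (2 * real n + 1) / (real n + 1)"
    proof -
      have "2 + e * z n = (2 * real n + 1) / real n" using n0 e by (simp add: z_def field_simps)
      then show ?thesis unfolding a using n0 by simp
    qed
    then have bS: "b (Suc n) = 2 * t * (2 + e * z n) / a * b n"
      unfolding b_def central_term_Suc by simp
    have rec: "1 / v (z n) - 1 - 2 * t * (2 + e * z n) / a * (1 / v (z (Suc n))) =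
      z n ^ 6 * (approx_defect t (z n) / (v (z n) * W (z n)))"
      using approx_recurrence[of t "z n"] N[OF n] n0 e a
      unfolding et a_def[symmetric] za v_def[symmetric] W_def[symmetric] by simp
    have "2 * race_prob q (Suc n) / d = 2 * race_prob q n / d - b n"
      using race_prob_Suc[OF n0, of q] d unfolding b_def central_term_def t_def d_def
      by (simp add: field_simps)
    then have "M n - M (Suc n) = - (b n * (1 / v (z n) - 1 - \<kappa> * (1 / v (z (Suc n)))))"
      if "b (Suc n) = \<kappa> * b n" for \<kappa>
      unfolding M_def that by (simp add: algebra_simps)
    from this[OF bS] show ?thesis unfolding rec .
  qed
  have M_le: "\<bar>M n\<bar> \<le> b n * (K * z n ^ 6) / (1 - 4 * t)" if "N \<le> n" for n
  proof (rule geometric_tail_comparison[where N = N and b = b and M = M and \<delta> = "\<lambda>n. K * z n ^ 6"])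
    show "b (Suc n) \<le> 4 * t * b n" for n
      unfolding b_def using t by (intro central_term_Suc_le) simp
    show "b \<longlonglongrightarrow> 0" unfolding b_def using t e et by (intro central_term_tendsto_0) auto
    show "0 \<le> K * z n ^ 6" for n by (simp add: K_def)
    show "K * z (Suc n) ^ 6 \<le> K * z n ^ 6" if "N \<le> n" for n
      using N[OF that] e
      by (intro mult_left_mono power_mono) (auto simp: K_def z_def intro!: divide_left_mono mult_left_mono)
    show "\<bar>M n - M (Suc n)\<bar> \<le> b n * (K * z n ^ 6)" if "N \<le> n" for n
    proof -
      have "\<bar>M n - M (Suc n)\<bar> = b n * (\<bar>approx_defect t (z n) / (v (z n) * W (z n))\<bar> * z n ^ 6)"
        unfolding step[OF that] using b[of n] by (simp add: abs_mult)
      also have "\<dots> \<le> b n * (K * z n ^ 6)"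
        using b[of n] N[OF that] by (intro mult_left_mono mult_right_mono) auto
      finally show ?thesis .
    qed
    have "M \<longlonglongrightarrow> 2 * 0 / d - 0 / e"
      unfolding M_def using e d
      by (intro tendsto_intros race_prob_tendsto_0 q lims \<open>b \<longlonglongrightarrow> 0\<close>) auto
    then show "M \<longlonglongrightarrow> 0" by simp
  qed (use b that e et in \<open>auto intro: less_imp_le\<close>)
  \<comment> \<open>Collects the bound \<open>e + 1\<close> on \<open>v\<close>, the factor
    \<open>K / e\<close> from the tail comparison, the prefactor \<open>n / (2 * q * e)\<close> and
    \<open>z n ^ 6 = 1 / (e ^ 6 * n ^ 6)\<close>.\<close>
  define C where "C = (e + 1) * K / (2 * q * e * e * e ^ 6)"
  show ?thesis
  proof (rule bigoI[where c = C], rule eventually_sequentiallyI)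
    fix n assume n: "N \<le> n"
    have n0: "0 < n" and v: "0 < v (z n)" "v (z n) < e + 1" using N[OF n] by auto
    define U where "U = 2 * race_prob q n / (d * b n)"
    \<comment> \<open>Nonnegativity of the next race probability gives \<open>U \<ge> 1\<close>, so
      passing from \<open>U\<close> to \<open>1 / U\<close> does not enlarge the error beyond the
      factor \<open>v (z n)\<close>.\<close>
    have "b n \<le> 2 * race_prob q n / d"
    proof -
      have "0 \<le> race_prob q (Suc n)" using q by (intro race_prob_nonneg) auto
      then show ?thesis using race_prob_Suc[OF n0, of q] d
        unfolding b_def central_term_def t_def d_def by (simp add: field_simps)
    qed
    then have U: "1 \<le> U" using b[of n] d by (simp add: U_def field_simps)
    have "1 / U - v (z n) = v (z n) * ((1 / v (z n) - U) / U)"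
      using U v by (simp add: field_simps)
    also have "1 / v (z n) - U = - (M n / b n)"
      using b[of n] v d by (simp add: M_def U_def field_simps)
    finally have "\<bar>1 / U - v (z n)\<bar> = v (z n) * (\<bar>M n\<bar> / b n / U)"
      using b[of n] v U by (simp add: abs_mult)
    also have "\<dots> \<le> (e + 1) * (K * z n ^ 6 / e)"
    proof (rule mult_mono)
      have "\<bar>M n\<bar> / b n / U \<le> \<bar>M n\<bar> / b n"
        using divide_left_mono[of 1 U "\<bar>M n\<bar> / b n"] U b[of n] by simp
      also have "\<dots> \<le> K * z n ^ 6 / e"
        using M_le[OF n] b[of n] e unfolding et by (simp add: field_simps)
      finally show "\<bar>M n\<bar> / b n / U \<le> K * z n ^ 6 / e" .
    qed (use v e b[of n] U in auto)
    finally have "real n / (2 * q * e) * \<bar>1 / U - v (z n)\<bar> \<le>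
        real n / (2 * q * e) * ((e + 1) * (K * z n ^ 6 / e))"
      using q e by (intro mult_left_mono) auto
    also have "\<dots> = C * (1 / real n ^ 5)"
      using q e n0 by (simp add: C_def z_def field_simps eval_nat_numeral)
    finally have "real n / (2 * q * e) * \<bar>1 / U - v (z n)\<bar> \<le> C * (1 / real n ^ 5)" .
    moreover have "cond_expected_duration n q - real n / (2 * q * e) * (v (z n) - e) =
      real n / (2 * q * e) * (1 / U - v (z n))"
    proof -
      have "d * b n / (2 * race_prob q n) = 1 / U" by (simp add: U_def)
      then have "cond_expected_duration n q = real n / (2 * q * e) * (1 / U - e)"
        using cond_expected_duration_closed_form[OF q n0]
        by (simp only: d(2) d_def t_def b_def)
      then show ?thesis by (simp only: right_diff_distrib)
    qed
    ultimately show "norm (cond_expected_duration n q - real n / (2 * q * e) * (approx t (1 / (e * real n)) - e))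
      \<le> C * norm (1 / real n ^ 5)"
      using q e unfolding v_def z_def by (simp add: abs_mult)
  qed
qed

theorem theorem5:
  fixes q :: real
  assumes "0 < q" and "q < 1 / 2"
  shows "(\<lambda>n. cond_expected_duration n q) \<longlonglongrightarrow> (1 - q) / (1 - 2 * q) ^ 2 \<and>
    (\<lambda>n. cond_expected_duration n q -
      (1 - q) / (1 - 2 * q) ^ 2 *
       (1 - 1 / (1 - 2 * q) ^ 2 * (1 / real n)
          - (6 * q ^ 2 - 6 * q - 1) / (1 - 2 * q) ^ 4 * (1 / real n ^ 2)
          - (36 * q ^ 4 - 72 * q ^ 3 + 12 * q ^ 2 + 24 * q + 1) / (1 - 2 * q) ^ 6
              * (1 / real n ^ 3)
          - (216 * q ^ 6 - 648 * q ^ 5 + 276 * q ^ 4 + 528 * q ^ 3 - 306 * q ^ 2 - 66 * q - 1)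
              / (1 - 2 * q) ^ 8 * (1 / real n ^ 4)))
     \<in> O(\<lambda>n. 1 / real n ^ 5)"
    (is "?E \<longlonglongrightarrow> ?l \<and> (\<lambda>n. ?E n - ?T n) \<in> _")
proof
  have eq: "\<forall>\<^sub>F n in sequentially. ?E n - real n / (2 * q * (1 - 2 * q) ^ 2) *
      (approx (q * (1 - q)) (1 / ((1 - 2 * q) ^ 2 * real n)) - (1 - 2 * q) ^ 2) = ?E n - ?T n"
    using eventually_gt_at_top[of 0] by eventually_elim (simp only: expansion_eq_approx[OF assms])
  show O: "(\<lambda>n. ?E n - ?T n) \<in> O(\<lambda>n. 1 / real n ^ 5)"
    using duration_expansion_bound[OF assms] landau_o.big.in_cong[OF eq] by simp
  have pow: "(\<lambda>n. 1 / real n ^ k) \<longlonglongrightarrow> 0" if "0 < k" for k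
    using tendsto_null_power[OF lim_1_over_n that] by (simp add: power_divide)
  \<comment> \<open>The limit is read off from the expansion, since the error and all correction
    terms vanish.\<close>
  have "(\<lambda>n. ?E n - ?T n) \<longlonglongrightarrow> 0"
  proof -
    obtain c where "\<forall>\<^sub>F n in sequentially. norm (?E n - ?T n) \<le> c * norm (1 / real n ^ 5)"
      using O by (auto elim: landau_o.bigE)
    moreover have "(\<lambda>n. c * norm (1 / real n ^ 5)) \<longlonglongrightarrow> 0"
      using tendsto_mult_right_zero[OF tendsto_norm_zero[OF pow[of 5]], of c] by simp
    ultimately show ?thesis by (rule Lim_null_comparison)
  qed
  moreover have "?T \<longlonglongrightarrow> ?l * (1 - 1 / (1 - 2 * q) ^ 2 * 0
      - (6 * q ^ 2 - 6 * q - 1) / (1 - 2 * q) ^ 4 * 0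
      - (36 * q ^ 4 - 72 * q ^ 3 + 12 * q ^ 2 + 24 * q + 1) / (1 - 2 * q) ^ 6 * 0
      - (216 * q ^ 6 - 648 * q ^ 5 + 276 * q ^ 4 + 528 * q ^ 3 - 306 * q ^ 2 - 66 * q - 1)
          / (1 - 2 * q) ^ 8 * 0)"
    by (intro tendsto_mult tendsto_diff tendsto_const lim_1_over_n pow) simp_all
  ultimately show "?E \<longlonglongrightarrow> ?l"
    using tendsto_add[of "\<lambda>n. ?E n - ?T n" 0 sequentially ?T] by simp
qed

end
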